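(* Let $A\subset\mathbb R$ be a compact interval with diameter $\Delta$, let $\mu_1,\mu_2,\nu_1,\nu_2$ be four probability measures supported on $A$, and let $t\in(0,1)$. For $K>\Delta$ let $\tau_K:x\mapsto x+K$ and $$\mu:=(1-t)\mu_1+t\,\tau_{K\#}\mu_2,\qquad \nu:=(1-t)\nu_1+t\,\tau_{K\#}\nu_2.$$ Then for $K$ large enough, the unique optimal plan for the squared distance Gromov--Wasserstein problem $$\min_{\pi\in\Pi(\mu,\nu)}\int\int\big|(x-x')^2-(y-y')^2\big|^2\,d\pi(x,y)\,d\pi(x',y')$$ between $\mu$ and $\nu$ is given by one of the two monotone rearrangements (non-decreasing or non-increasing) between $\mu$ and $\nu$.
   Context: $\Pi(\mu,\nu)$ is the set of probability measures on $\mathbb R\times\mathbb R$ with marginals $\mu$ and $\nu$; $\tau_{K\#}$ denotes pushforward by $\tau_K$. The non-decreasing rearrangement between $\mu$ and $\nu$ is the plan that matches the quantiles of $\mu$ and $\nu$ with each other, i.e. the law of $(F_\mu^{-1}(U),F_\nu^{-1}(U))$ with $U$ uniform on $(0,1)$ and $F_\mu^{-1},F_\nu^{-1}$ the quantile functions; the non-increasing rearrangement matches the quantiles in reverse, i.e. it is the law of $(F_\mu^{-1}(U),F_\nu^{-1}(1-U))$.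
   Formalization: Uniqueness is claimed only if t ≠ 1/2 or the two monotone rearrangements have different costs; in a tie at t = 1/2 (e.g. all four measures δ_0) both are optimal, so uniqueness fails. Existence, and that every optimal plan is one of the two, hold for all t. *)

theory Defs
  imports "HOL-Probability.Probability"
begin

definition mixture :: "real \<Rightarrow> real measure \<Rightarrow> real measure \<Rightarrow> real measure" where
  "mixture t M N =
    measure_of UNIV (sets borel) (\<lambda>B. ennreal (1 - t) * emeasure M B + ennreal t * emeasure N B)"

definition couplings :: "real measure \<Rightarrow> real measure \<Rightarrow> (real \<times> real) measure set" where
  "couplings \<mu> \<nu> =
    {\<pi>. prob_space \<pi> \<and> sets \<pi> = sets borel \<and> distr \<pi> borel fst = \<mu> \<and> distr \<pi> borel snd = \<nu>}"

text \<open>The integrand is nonnegative, so the cost is taken in the extended nonnegative reals; this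
  avoids the default value 0 of the Bochner integral for non-integrable functions.\<close>

definition gw_cost :: "(real \<times> real) measure \<Rightarrow> ennreal" where
  "gw_cost \<pi> =
    (\<integral>\<^sup>+ (x', y'). (\<integral>\<^sup>+ (x, y). ennreal (\<bar>(x - x')\<^sup>2 - (y - y')\<^sup>2\<bar>\<^sup>2) \<partial>\<pi>) \<partial>\<pi>)"

definition gw_optimal :: "real measure \<Rightarrow> real measure \<Rightarrow> (real \<times> real) measure \<Rightarrow> bool" where
  "gw_optimal \<mu> \<nu> \<pi> \<longleftrightarrow> is_arg_min gw_cost (\<lambda>\<pi>'. \<pi>' \<in> couplings \<mu> \<nu>) \<pi>"

definition quantile :: "real measure \<Rightarrow> real \<Rightarrow> real" where
  "quantile M u = Inf {x. u \<le> cdf M x}"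

text \<open>Lebesgue measure restricted to the open unit interval is the law of a uniform variable.\<close>

definition nondecreasing_rearrangement ::
    "real measure \<Rightarrow> real measure \<Rightarrow> (real \<times> real) measure" where
  "nondecreasing_rearrangement \<mu> \<nu> =
    distr (restrict_space lborel {0<..<1}) borel (\<lambda>u. (quantile \<mu> u, quantile \<nu> u))"

definition nonincreasing_rearrangement ::
    "real measure \<Rightarrow> real measure \<Rightarrow> (real \<times> real) measure" where
  "nonincreasing_rearrangement \<mu> \<nu> =
    distr (restrict_space lborel {0<..<1}) borel (\<lambda>u. (quantile \<mu> u, quantile \<nu> (1 - u)))"

text \<open>\<^const>\<open>measure_of\<close> and \<^const>\<open>distr\<close> return degenerate measures when their side conditions
  fail; the following facts show that they hold here.\<close>

lemma sets_mixture [simp, measurable_cong]: "sets (mixture t M N) = sets borel"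
  unfolding mixture_def using sets.sigma_sets_eq[of "borel :: real measure"] by simp

lemma emeasure_mixture:
  assumes "sets M = sets borel" "sets N = sets borel" "B \<in> sets borel"
  shows "emeasure (mixture t M N) B = ennreal (1 - t) * emeasure M B + ennreal t * emeasure N B"
proof (rule emeasure_measure_of[OF mixture_def])
  show "sets borel \<subseteq> Pow (UNIV :: real set)" by simp
  show "B \<in> sets (mixture t M N)" using assms by simp
  show "positive (sets (mixture t M N))
      (\<lambda>B. ennreal (1 - t) * emeasure M B + ennreal t * emeasure N B)"
    by (simp add: positive_def)
  show "countably_additive (sets (mixture t M N))
      (\<lambda>B. ennreal (1 - t) * emeasure M B + ennreal t * emeasure N B)"
  proof (rule countably_additiveI)
    fix F :: "nat \<Rightarrow> real set"
    assume F: "range F \<subseteq> sets (mixture t M N)" "disjoint_family F"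
    have "(\<Sum>i. emeasure M (F i)) = emeasure M (\<Union>i. F i)"
      "(\<Sum>i. emeasure N (F i)) = emeasure N (\<Union>i. F i)"
      using F assms by (auto intro!: suminf_emeasure)
    then show "(\<Sum>i. ennreal (1 - t) * emeasure M (F i) + ennreal t * emeasure N (F i)) =
        ennreal (1 - t) * emeasure M (\<Union>i. F i) + ennreal t * emeasure N (\<Union>i. F i)"
      by (simp add: suminf_add[symmetric] ennreal_suminf_cmult)
  qed
qed

lemma real_distribution_mixture:
  assumes "real_distribution M" "real_distribution N" "0 \<le> t" "t \<le> 1"
  shows "real_distribution (mixture t M N)"
proof -
  interpret M: real_distribution M by fact
  interpret N: real_distribution N by fact
  have "space (mixture t M N) = UNIV"
    using sets_eq_imp_space_eq[OF sets_mixture] by simp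
  then have "prob_space (mixture t M N)"
    using assms M.emeasure_space_1 N.emeasure_space_1
    by (intro prob_spaceI) (simp add: emeasure_mixture flip: ennreal_plus)
  then show ?thesis
    by (simp add: real_distribution_def real_distribution_axioms_def)
qed

lemma measurable_quantile:
  assumes "real_distribution M"
  shows "quantile M \<in> borel_measurable (restrict_space borel {0<..<1})"
    and "distr (restrict_space lborel {0<..<1}) borel (quantile M) = M"
proof -
  interpret cdf_distribution M
    using assms by (simp add: cdf_distribution_def)
  have "quantile M = (\<lambda>u. Inf {x. u \<le> cdf M x})"
    by (simp add: quantile_def fun_eq_iff)
  then show "quantile M \<in> borel_measurable (restrict_space borel {0<..<1})"
    "distr (restrict_space lborel {0<..<1}) borel (quantile M) = M"
    using measurable_CI distr_I_eq_M by simp_all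
qed

lemma measurable_quantile_reflect:
  assumes "real_distribution M"
  shows "(\<lambda>u. quantile M (1 - u)) \<in> borel_measurable (restrict_space borel {0<..<1})"
  by (rule measurable_compose[OF _ measurable_quantile(1)[OF assms]])
    (rule measurable_restrict_space3, auto)

end

theory Submission
  imports Defs
begin

text \<open>
  With centred coordinates \<open>X\<close>, \<open>Y\<close>, expanding the square shows that the cost of a coupling is a
  constant minus \<open>4 (E[X\<^sup>2 Y\<^sup>2] + 2 E[X Y]\<^sup>2)\<close>. By Hoeffding's identity the difference of this gain
  between the comonotone coupling \<open>\<pi>\<^sub>0\<close> and a coupling \<open>\<pi>\<close> is \<open>4 \<integral>\<integral> ((u - m)(v - n) + s) D(u,v) du dv\<close>,
  where \<open>D \<ge> 0\<close> is the difference of the joint survival functions, \<open>m\<close> and \<open>n\<close> are the means and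
  \<open>s\<close> is the average of the two covariances.
  Let \<open>p\<close> be the mass that \<open>\<pi>\<close> sends from the lower to the upper cluster. The weight is positive
  on the two diagonal blocks, \<open>D \<le> p\<close> everywhere else, and \<open>D = p\<close> on the square of the gaps, which
  contributes \<open>K\<^sup>4 p (1 - 2p)\<close> to leading order and dominates the \<open>O(p K\<^sup>3)\<close> of the remaining region as long
  as \<open>p\<close> stays away from \<open>1/2\<close>. Since \<open>p \<le> min t (1 - t)\<close>, only \<open>t = 1/2\<close> needs more: if
  \<open>p > 1/4\<close>, reflecting the second coordinate replaces \<open>p\<close> by \<open>1/2 - p\<close> and the non-increasing
  rearrangement takes over the role of the comonotone coupling.
\<close>

subsection \<open>Joint survival functions\<close>

lemma (in pair_sigma_finite) integral_times:
  fixes f g :: "_ \<Rightarrow> real"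
  assumes f: "integrable M1 f" and g: "integrable M2 g"
  shows integrable_times: "integrable (M1 \<Otimes>\<^sub>M M2) (\<lambda>z. f (fst z) * g (snd z))"
    and "(\<integral>z. f (fst z) * g (snd z) \<partial>(M1 \<Otimes>\<^sub>M M2)) = integral\<^sup>L M1 f * integral\<^sup>L M2 g"
proof -
  note [measurable] = borel_measurable_integrable[OF f] borel_measurable_integrable[OF g]
  show int: "integrable (M1 \<Otimes>\<^sub>M M2) (\<lambda>z. f (fst z) * g (snd z))"
    by (rule Fubini_integrable) (use f g in \<open>auto simp: abs_mult\<close>)
  show "(\<integral>z. f (fst z) * g (snd z) \<partial>(M1 \<Otimes>\<^sub>M M2)) = integral\<^sup>L M1 f * integral\<^sup>L M2 g"
    using integral_fst'[OF int] by simp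
qed

lemma lborel_integral_times:
  fixes f g :: "real \<Rightarrow> real"
  assumes "integrable lborel f" "integrable lborel g"
  shows lborel_integrable_times: "integrable lborel (\<lambda>w. f (fst w) * g (snd w))"
    and "(\<integral>w. f (fst w) * g (snd w) \<partial>lborel) = integral\<^sup>L lborel f * integral\<^sup>L lborel g"
  using lborel_pair.integral_times[OF assms] unfolding lborel_prod by auto

definition joint_survival :: "(real \<times> real) measure \<Rightarrow> real \<Rightarrow> real \<Rightarrow> real" where
  "joint_survival \<pi> u v = measure \<pi> ({u<..} \<times> {v<..})"

text \<open>Fubini for the kernel \<open>f u * g v\<close> restricted to \<open>u < x\<close> and
  \<open>v < y\<close>: integrating over \<open>(u, v)\<close> first leaves a product of primitives
  of \<open>f\<close> and \<open>g\<close>, integrating over \<pi> first leaves the joint survival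
  function. The weights decide which mixed moment of \<pi> appears.\<close>

lemma survival_integral:
  fixes f g :: "real \<Rightarrow> real" and \<pi> :: "(real \<times> real) measure"
  assumes "prob_space \<pi>" and sets[measurable_cong]: "sets \<pi> = sets borel"
    and f: "integrable lborel f" and g: "integrable lborel g"
  shows "integrable lborel (\<lambda>w. f (fst w) * g (snd w) * joint_survival \<pi> (fst w) (snd w))" (is ?I)
    and "(\<integral>z. (\<integral>u. f u * indicator {..<fst z} u \<partial>lborel) *
            (\<integral>v. g v * indicator {..<snd z} v \<partial>lborel) \<partial>\<pi>) =
         (\<integral>w. f (fst w) * g (snd w) * joint_survival \<pi> (fst w) (snd w) \<partial>lborel)" (is ?E)
    and "integrable \<pi> (\<lambda>z. (\<integral>u. f u * indicator {..<fst z} u \<partial>lborel) *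
            (\<integral>v. g v * indicator {..<snd z} v \<partial>lborel))" (is ?F)
proof -
  interpret P: prob_space \<pi> by fact
  interpret PL: pair_sigma_finite \<pi> "lborel :: (real \<times> real) measure" ..
  note [measurable] = borel_measurable_integrable[OF f] borel_measurable_integrable[OF g]
  have sp: "space \<pi> = UNIV" using sets_eq_imp_space_eq[OF sets] by simp
  define k :: "(real \<times> real) \<Rightarrow> (real \<times> real) \<Rightarrow> real" where
    "k z w = f (fst w) * g (snd w) * indicator {..<fst z} (fst w) * indicator {..<snd z} (snd w)" for z w
  \<comment> \<open>As a function of \<open>w\<close> the kernel is a product of half-line
    indicators; as a function of \<open>z\<close> it is the indicator of the open quadrant with
    corner \<open>w\<close>.\<close>
  have k_alt: "k z w = f (fst w) * g (snd w) * indicator ({fst w<..} \<times> {snd w<..}) z" for z w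
    by (cases z) (auto simp: k_def indicator_def)
  have km[measurable]: "case_prod k \<in> borel_measurable (\<pi> \<Otimes>\<^sub>M lborel)"
  proof -
    have pi: "fst \<in> borel_measurable \<pi>" "snd \<in> borel_measurable \<pi>"
      by (simp_all add: measurable_cong_sets[OF sets refl] borel_prod[symmetric])
    have lb: "fst \<in> borel_measurable (lborel :: (real\<times>real) measure)"
      "snd \<in> borel_measurable (lborel :: (real\<times>real) measure)"
      by (simp_all add: measurable_lborel1 borel_prod[symmetric])
    note m1 = measurable_compose[OF measurable_fst pi(1)] measurable_compose[OF measurable_fst pi(2)]
      and m2 = measurable_compose[OF measurable_snd lb(1)] measurable_compose[OF measurable_snd lb(2)]
    have fg: "f \<in> borel_measurable borel" "g \<in> borel_measurable borel" by simp_all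
    have "case_prod k = (\<lambda>q. f (fst (snd q)) * g (snd (snd q)) *
        (if fst (snd q) < fst (fst q) then 1 else 0) * (if snd (snd q) < snd (fst q) then 1 else 0))"
      by (auto simp: k_def indicator_def fun_eq_iff)
    also have "\<dots> \<in> borel_measurable (\<pi> \<Otimes>\<^sub>M lborel)"
      by (intro borel_measurable_times measurable_compose[OF m2(1) fg(1)] measurable_compose[OF m2(2) fg(2)]
        measurable_If borel_measurable_const borel_measurable_less m1 m2)
    finally show ?thesis .
  qed
  have int: "integrable (\<pi> \<Otimes>\<^sub>M lborel) (case_prod k)"
  proof (rule Bochner_Integration.integrable_bound)
    \<comment> \<open>Dropping the indicators leaves a function of \<open>w\<close> alone; the
      factor 1 presents it as a product over \<pi> and \<open>lborel\<close>.\<close>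
    show "integrable (\<pi> \<Otimes>\<^sub>M lborel) (\<lambda>q. 1 * (f (fst (snd q)) * g (snd (snd q))))"
      using PL.integrable_times[of "\<lambda>_. 1", OF _ lborel_integrable_times[OF f g]] by simp
    show "AE q in \<pi> \<Otimes>\<^sub>M lborel. norm (case_prod k q) \<le> norm (1 * (f (fst (snd q)) * g (snd (snd q))))"
      by (auto simp: k_def indicator_def)
  qed (rule km)
  have inner2: "(\<integral>z. k z w \<partial>\<pi>) = f (fst w) * g (snd w) * joint_survival \<pi> (fst w) (snd w)" for w
    by (simp add: k_alt joint_survival_def sp)
  have inner1: "(\<integral>w. k z w \<partial>lborel) =
      (\<integral>u. f u * indicator {..<fst z} u \<partial>lborel) * (\<integral>v. g v * indicator {..<snd z} v \<partial>lborel)" for z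
  proof -
    have "integrable lborel (\<lambda>u. f u * indicator {..<fst z} u)" "integrable lborel (\<lambda>v. g v * indicator {..<snd z} v)"
      using f g by (auto intro!: integrable_real_mult_indicator)
    from lborel_integral_times(2)[OF this] show ?thesis
      by (simp add: k_def mult_ac)
  qed
  show ?I using PL.integrable_snd[OF int] by (simp add: inner2)
  show ?F using PL.integrable_fst[OF int] by (simp add: inner1)
  show ?E using PL.Fubini_integral[OF int] by (simp add: inner1 inner2)
qed

text \<open>The primitives for \<open>survival_integral\<close>: the constant weight leads to
  E[X Y], the linear weight to E[X^2 Y^2], each up to terms in the marginals.\<close>

lemma integral_interval_below:
  fixes a b x m :: real
  assumes "a \<le> x" "x \<le> b"
  shows "(\<integral>u. indicator {a..b} u * indicator {..<x} u \<partial>lborel) = x - a"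
    and "(\<integral>u. (u - m) * indicator {a..b} u * indicator {..<x} u \<partial>lborel)
         = ((x - m)\<^sup>2 - (a - m)\<^sup>2) / 2"
proof -
  \<comment> \<open>The half-line is open at \<open>x\<close> while the interval of integration is
    closed; the difference is a null set.\<close>
  have ae: "AE u in lborel. indicator {a..b} u * indicator {..<x} u = (indicator {a..x} u :: real)"
    using AE_lborel_singleton[of x] by eventually_elim (use assms in \<open>auto simp: indicator_def\<close>)
  have "(\<integral>u. indicator {a..b} u * indicator {..<x} u \<partial>lborel) = (\<integral>u. (indicator {a..x} u :: real) \<partial>lborel)"
    by (rule integral_cong_AE) (measurable, use ae in simp)
  then show "(\<integral>u. indicator {a..b} u * indicator {..<x} u \<partial>lborel) = x - a"
    using assms by simp
  have "(\<integral>u. (u - m) * indicator {a..b} u * indicator {..<x} u \<partial>lborel) =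
      (\<integral>u. (u - m) * indicator {a..x} u \<partial>lborel)"
    by (rule integral_cong_AE) (measurable, use ae in \<open>eventually_elim; simp add: mult.assoc\<close>)
  also have "\<dots> = (x - m)\<^sup>2 / 2 - (a - m)\<^sup>2 / 2"
    by (rule integral_FTC_Icc_real) (use assms in \<open>auto intro!: derivative_eq_intros\<close>)
  finally show "(\<integral>u. (u - m) * indicator {a..b} u * indicator {..<x} u \<partial>lborel)
         = ((x - m)\<^sup>2 - (a - m)\<^sup>2) / 2" by (simp add: diff_divide_distrib)
qed

lemma integrable_interval:
  fixes a b m :: real
  shows "integrable lborel (indicator {a..b} :: real \<Rightarrow> real)"
    and "integrable lborel (\<lambda>u. (u - m) * indicator {a..b} u)"
proof -
  show "integrable lborel (indicator {a..b} :: real \<Rightarrow> real)"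
    by (rule integrable_real_indicator) (auto simp: emeasure_lborel_Icc_eq)
  show "integrable lborel (\<lambda>u. (u - m) * indicator {a..b} u)"
    using borel_integrable_compact[of "{a..b}" "\<lambda>u. u - m"]
    by (simp add: mult.commute continuous_intros)
qed

text \<open>Open upper quadrants are closed under intersection, generate the Borel sets of the plane
  and exhaust it. They are the sets above a point for the coordinatewise strict order
  \<open>eucl_less\<close>.\<close>

lemma prob_eqI_joint_survival:
  assumes "prob_space \<pi>" "prob_space \<pi>'" "sets \<pi> = sets borel" "sets \<pi>' = sets borel"
    and eq: "\<And>u v. joint_survival \<pi> u v = joint_survival \<pi>' u v"
  shows "\<pi> = \<pi>'"
proof -
  interpret P: prob_space \<pi> by fact
  interpret P': prob_space \<pi>' by fact
  let ?E = "range (\<lambda>a::real\<times>real. {x. eucl_less a x})"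
  have E: "{x. eucl_less a x} = {fst a<..} \<times> {snd a<..}" for a :: "real \<times> real"
    by (auto simp: eucl_less_def Basis_prod_def inner_prod_def)
  have em: "emeasure \<pi> X = emeasure \<pi>' X" if "X \<in> ?E" for X
    using that eq by (auto simp: E joint_survival_def P.emeasure_eq_measure P'.emeasure_eq_measure)
  show ?thesis
  proof (rule measure_eqI_generator_eq[of ?E UNIV \<pi> \<pi>' "\<lambda>i. {(- real i)<..} \<times> {(- real i)<..}"])
    show "Int_stable ?E"
    proof (rule Int_stableI)
      fix X Y assume "X \<in> ?E" "Y \<in> ?E"
      then obtain a b :: "real \<times> real" where "X = {fst a<..} \<times> {snd a<..}" "Y = {fst b<..} \<times> {snd b<..}"
        by (auto simp: E)
      then have "X \<inter> Y = {max (fst a) (fst b)<..} \<times> {max (snd a) (snd b)<..}" by auto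
      also have "\<dots> = {x. eucl_less (max (fst a) (fst b), max (snd a) (snd b)) x}" by (simp add: E)
      finally show "X \<inter> Y \<in> ?E" by blast
    qed
    have "sets (borel :: (real \<times> real) measure) = sigma_sets UNIV ?E"
      using arg_cong[OF borel_eq_greaterThan, of sets] by simp
    then show "sets \<pi> = sigma_sets UNIV ?E" "sets \<pi>' = sigma_sets UNIV ?E"
      using assms by simp_all
    show "range (\<lambda>i. {- real i<..} \<times> {- real i<..}) \<subseteq> ?E"
    proof safe
      fix i :: nat
      have "{- real i<..} \<times> {- real i<..} = {x. eucl_less (- real i, - real i) x}" by (simp add: E)
      then show "{- real i<..} \<times> {- real i<..} \<in> ?E" by blast
    qed
    show "(\<Union>i. {- real i<..} \<times> {- real i<..}) = UNIV"
    proof safe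
      fix x y :: real
      obtain n where "max (- x) (- y) < real n" using reals_Archimedean2 by blast
      then have "(x, y) \<in> {- real n<..} \<times> {- real n<..}" by auto
      then show "(x, y) \<in> (\<Union>i. {- real i<..} \<times> {- real i<..})" by blast
    qed auto
    show "emeasure \<pi> ({- real i<..} \<times> {- real i<..}) \<noteq> \<infinity>" for i by simp
  qed (use em in auto)
qed

lemma measurable_coupling:
  assumes "\<pi> \<in> couplings \<mu> \<nu>"
  shows "fst \<in> borel_measurable \<pi>" "snd \<in> borel_measurable \<pi>"
proof -
  have sets: "sets \<pi> = sets borel" using assms by (simp add: couplings_def)
  show "fst \<in> borel_measurable \<pi>" "snd \<in> borel_measurable \<pi>"
    by (simp_all add: measurable_cong_sets[OF sets refl] borel_prod[symmetric])
qed

lemma coupling_marginal: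
  assumes c: "\<pi> \<in> couplings \<mu> \<nu>" and B: "B \<in> sets borel"
  shows "measure \<mu> B = measure \<pi> (B \<times> UNIV)" "measure \<nu> B = measure \<pi> (UNIV \<times> B)"
proof -
  have sp: "space \<pi> = UNIV" using c sets_eq_imp_space_eq[of \<pi> borel] by (auto simp: couplings_def)
  have "\<mu> = distr \<pi> borel fst" "\<nu> = distr \<pi> borel snd" using c by (auto simp: couplings_def)
  moreover have "(fst :: real \<times> real \<Rightarrow> real) -` B = B \<times> UNIV" "(snd :: real \<times> real \<Rightarrow> real) -` B = UNIV \<times> B" by auto
  ultimately show "measure \<mu> B = measure \<pi> (B \<times> UNIV)" "measure \<nu> B = measure \<pi> (UNIV \<times> B)"
    using measurable_coupling[OF c] B by (simp_all add: measure_distr sp)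
qed

lemma sets_coupling_Times:
  assumes "\<pi> \<in> couplings \<mu> \<nu>" "B \<in> sets borel" "C \<in> sets borel"
  shows "B \<times> C \<in> sets \<pi>"
proof -
  have "sets \<pi> = sets (borel \<Otimes>\<^sub>M borel)" unfolding borel_prod using assms by (simp add: couplings_def)
  then show ?thesis using assms by simp
qed

lemma joint_survival_le:
  assumes c: "\<pi> \<in> couplings \<mu> \<nu>"
  shows "joint_survival \<pi> u v \<le> measure \<mu> {u<..}" "joint_survival \<pi> u v \<le> measure \<nu> {v<..}"
proof -
  interpret prob_space \<pi> using c by (simp add: couplings_def)
  show "joint_survival \<pi> u v \<le> measure \<mu> {u<..}" "joint_survival \<pi> u v \<le> measure \<nu> {v<..}"
    unfolding joint_survival_def coupling_marginal[OF c, of "{_<..}", simplified]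
    by (auto intro!: finite_measure_mono sets_coupling_Times[OF c])
qed

text \<open>The Frechet-Hoeffding upper bound attained at every quadrant at once; by
  \<open>joint_survival_le\<close> no coupling exceeds it.\<close>

definition comonotone_coupling :: "real measure \<Rightarrow> real measure \<Rightarrow> (real \<times> real) measure \<Rightarrow> bool" where
  "comonotone_coupling \<mu> \<nu> \<pi> \<longleftrightarrow> \<pi> \<in> couplings \<mu> \<nu> \<and>
    (\<forall>u v. joint_survival \<pi> u v = min (measure \<mu> {u<..}) (measure \<nu> {v<..}))"

lemma joint_survival_le_comonotone:
  assumes "comonotone_coupling \<mu> \<nu> \<pi>0" "\<pi> \<in> couplings \<mu> \<nu>"
  shows "joint_survival \<pi> u v \<le> joint_survival \<pi>0 u v"
  using assms joint_survival_le[of \<pi> \<mu> \<nu> u v] by (simp add: comonotone_coupling_def)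

section \<open>Hoeffding identities for marginals on compact intervals\<close>

locale bounded_marginals =
  fixes \<mu> \<nu> :: "real measure" and a a' b b' :: real
  assumes mu: "real_distribution \<mu>" and nu: "real_distribution \<nu>"
    and mu_supp: "AE x in \<mu>. x \<in> {a..a'}" and nu_supp: "AE y in \<nu>. y \<in> {b..b'}"
begin

sublocale mu: real_distribution \<mu> by (rule mu)
sublocale nu: real_distribution \<nu> by (rule nu)

lemma AE_coupling:
  assumes c: "\<pi> \<in> couplings \<mu> \<nu>"
  shows "AE z in \<pi>. fst z \<in> {a..a'} \<and> snd z \<in> {b..b'}"
proof -
  have "AE x in distr \<pi> borel fst. x \<in> {a..a'}" "AE x in distr \<pi> borel snd. x \<in> {b..b'}"
    using c mu_supp nu_supp by (auto simp: couplings_def)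
  then have "AE z in \<pi>. fst z \<in> {a..a'}" "AE z in \<pi>. snd z \<in> {b..b'}"
    using measurable_coupling[OF c] by (auto simp: AE_distr_iff)
  then show ?thesis by eventually_elim simp
qed

lemma coupling_integrable:
  fixes h :: "real \<times> real \<Rightarrow> real"
  assumes c: "\<pi> \<in> couplings \<mu> \<nu>" and h: "continuous_on UNIV h"
  shows "integrable \<pi> h"
proof -
  interpret prob_space \<pi> using c by (simp add: couplings_def)
  have "compact (h ` ({a..a'} \<times> {b..b'}))"
    by (intro compact_continuous_image compact_Times continuous_on_subset[OF h]) auto
  then obtain B where "\<forall>y \<in> h ` ({a..a'} \<times> {b..b'}). norm y \<le> B"
    by (auto dest!: compact_imp_bounded simp only: bounded_iff)
  then have B: "norm (h z) \<le> B" if "z \<in> {a..a'} \<times> {b..b'}" for z using that by blast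
  show ?thesis
  proof (rule integrable_const_bound)
    show "AE z in \<pi>. norm (h z) \<le> B"
      using AE_coupling[OF c] by eventually_elim (rule B, simp add: mem_Times_iff)
    show "h \<in> borel_measurable \<pi>"
    proof -
      have sets: "sets \<pi> = sets borel" using c by (simp add: couplings_def)
      show ?thesis
        using borel_measurable_continuous_onI[OF h] by (simp add: measurable_cong_sets[OF sets refl])
    qed
  qed
qed

lemma integral_coupling_marginal:
  assumes c: "\<pi> \<in> couplings \<mu> \<nu>" and h: "continuous_on UNIV (h :: real \<Rightarrow> real)"
  shows "(\<integral>z. h (fst z) \<partial>\<pi>) = integral\<^sup>L \<mu> h" "(\<integral>z. h (snd z) \<partial>\<pi>) = integral\<^sup>L \<nu> h"
proof -
  have "\<mu> = distr \<pi> borel fst" "\<nu> = distr \<pi> borel snd" using c by (auto simp: couplings_def)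
  then show "(\<integral>z. h (fst z) \<partial>\<pi>) = integral\<^sup>L \<mu> h" "(\<integral>z. h (snd z) \<partial>\<pi>) = integral\<^sup>L \<nu> h"
    using measurable_coupling[OF c] borel_measurable_continuous_onI[OF h]
    by (simp_all add: integral_distr)
qed

text \<open>Only the mixed integral on the right depends on the coupling; the other terms are fixed
  by the marginals and cancel when two couplings are compared.\<close>

lemma integral_coupling_shift:
  assumes c: "\<pi> \<in> couplings \<mu> \<nu>"
    and h: "continuous_on UNIV (h :: real \<Rightarrow> real)" and k: "continuous_on UNIV (k :: real \<Rightarrow> real)"
  shows "(\<integral>z. (h (fst z) - p) * (k (snd z) - q) \<partial>\<pi>) =
    (\<integral>z. h (fst z) * k (snd z) \<partial>\<pi>) - q * integral\<^sup>L \<mu> h - p * integral\<^sup>L \<nu> k + p * q"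
proof -
  interpret prob_space \<pi> using c by (simp add: couplings_def)
  note cont = continuous_on_compose2[OF h, of _ fst] continuous_on_compose2[OF k, of _ snd] 
  have "(\<integral>z. (h (fst z) - p) * (k (snd z) - q) \<partial>\<pi>) =
      (\<integral>z. h (fst z) * k (snd z) - q * h (fst z) - p * k (snd z) + p * q \<partial>\<pi>)"
    by (simp add: algebra_simps)
  also have "\<dots> = (\<integral>z. h (fst z) * k (snd z) \<partial>\<pi>) - q * (\<integral>z. h (fst z) \<partial>\<pi>)
      - p * (\<integral>z. k (snd z) \<partial>\<pi>) + p * q"
  proof -
    have [simp]: "integrable \<pi> (\<lambda>z. h (fst z) * k (snd z))" "integrable \<pi> (\<lambda>z. h (fst z))"
        "integrable \<pi> (\<lambda>z. k (snd z))"
      by (auto intro!: coupling_integrable[OF c] continuous_intros cont)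
    show ?thesis by (simp add: prob_space)
  qed
  finally show ?thesis using integral_coupling_marginal[OF c] h k by simp
qed

text \<open>Hoeffding's covariance identity.\<close>
lemma survival_difference:
  assumes c: "\<pi> \<in> couplings \<mu> \<nu>" and c0: "\<pi>0 \<in> couplings \<mu> \<nu>"
  shows "integrable lborel (\<lambda>w. indicator {a..a'} (fst w) * indicator {b..b'} (snd w) *
           (joint_survival \<pi>0 (fst w) (snd w) - joint_survival \<pi> (fst w) (snd w)))" (is ?I1)
    and "(\<integral>w. indicator {a..a'} (fst w) * indicator {b..b'} (snd w) *
           (joint_survival \<pi>0 (fst w) (snd w) - joint_survival \<pi> (fst w) (snd w)) \<partial>lborel) =
         (\<integral>z. (fst z - m) * (snd z - n) \<partial>\<pi>0) - (\<integral>z. (fst z - m) * (snd z - n) \<partial>\<pi>)" (is ?E1)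
    and "integrable lborel (\<lambda>w. ((fst w - m) * indicator {a..a'} (fst w)) * ((snd w - n) * indicator {b..b'} (snd w)) *
           (joint_survival \<pi>0 (fst w) (snd w) - joint_survival \<pi> (fst w) (snd w)))" (is ?I2)
    and "4 * (\<integral>w. ((fst w - m) * indicator {a..a'} (fst w)) * ((snd w - n) * indicator {b..b'} (snd w)) *
           (joint_survival \<pi>0 (fst w) (snd w) - joint_survival \<pi> (fst w) (snd w)) \<partial>lborel) =
         (\<integral>z. (fst z - m)\<^sup>2 * (snd z - n)\<^sup>2 \<partial>\<pi>0) - (\<integral>z. (fst z - m)\<^sup>2 * (snd z - n)\<^sup>2 \<partial>\<pi>)" (is ?E2)
proof -
  have P: "prob_space \<pi>" "sets \<pi> = sets borel" "prob_space \<pi>0" "sets \<pi>0 = sets borel"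
    using c c0 by (auto simp: couplings_def)
  note s1 = survival_integral[OF _ _ integrable_interval(1)[of a a'] integrable_interval(1)[of b b']]
  note s2 = survival_integral[OF _ _ integrable_interval(2)[of m a a'] integrable_interval(2)[of n b b']]
  \<comment> \<open>Constant weights: the primitives are \<open>x - a\<close> and
    \<open>y - b\<close>, which are recentred at \<open>m\<close> and \<open>n\<close>.\<close>
  have J1: "(\<integral>w. indicator {a..a'} (fst w) * indicator {b..b'} (snd w) * joint_survival \<rho> (fst w) (snd w) \<partial>lborel)
     = (\<integral>z. (fst z - m) * (snd z - n) \<partial>\<rho>) - (b - n) * (\<integral>x. x - m \<partial>\<mu>) - (a - m) * (\<integral>y. y - n \<partial>\<nu>) + (a - m) * (b - n)"
    if r: "\<rho> \<in> couplings \<mu> \<nu>" for \<rho>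
  proof -
    have R: "prob_space \<rho>" "sets \<rho> = sets borel" using r by (auto simp: couplings_def)
    have "(\<integral>w. indicator {a..a'} (fst w) * indicator {b..b'} (snd w) * joint_survival \<rho> (fst w) (snd w) \<partial>lborel)
        = (\<integral>z. ((fst z - m) - (a - m)) * ((snd z - n) - (b - n)) \<partial>\<rho>)"
      unfolding s1(2)[OF R, symmetric]
    proof (rule integral_cong_AE)
      show "AE z in \<rho>. (LBINT u. indicat_real {a..a'} u * indicat_real {..<fst z} u) *
          (LBINT v. indicat_real {b..b'} v * indicat_real {..<snd z} v) =
          (fst z - m - (a - m)) * (snd z - n - (b - n))"
        using AE_coupling[OF r] by eventually_elim (simp add: integral_interval_below)
    qed (intro borel_measurable_integrable s1(3)[OF R] coupling_integrable[OF r] continuous_intros; simp)+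
    also have "\<dots> = (\<integral>z. (fst z - m) * (snd z - n) \<partial>\<rho>) - (b - n) * (\<integral>x. x - m \<partial>\<mu>)
        - (a - m) * (\<integral>y. y - n \<partial>\<nu>) + (a - m) * (b - n)"
      by (rule integral_coupling_shift[OF r]) (intro continuous_intros)+
    finally show ?thesis .
  qed
  \<comment> \<open>Linear weights: each primitive carries a factor 1/2, whence the 4.\<close>
  have J2: "4 * (\<integral>w. ((fst w - m) * indicator {a..a'} (fst w)) * ((snd w - n) * indicator {b..b'} (snd w)) * joint_survival \<rho> (fst w) (snd w) \<partial>lborel)
     = (\<integral>z. (fst z - m)\<^sup>2 * (snd z - n)\<^sup>2 \<partial>\<rho>) - (b - n)\<^sup>2 * (\<integral>x. (x - m)\<^sup>2 \<partial>\<mu>) - (a - m)\<^sup>2 * (\<integral>y. (y - n)\<^sup>2 \<partial>\<nu>) + (a - m)\<^sup>2 * (b - n)\<^sup>2"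
    if r: "\<rho> \<in> couplings \<mu> \<nu>" for \<rho>
  proof -
    have R: "prob_space \<rho>" "sets \<rho> = sets borel" using r by (auto simp: couplings_def)
    have "(\<integral>w. ((fst w - m) * indicator {a..a'} (fst w)) * ((snd w - n) * indicator {b..b'} (snd w)) * joint_survival \<rho> (fst w) (snd w) \<partial>lborel)
        = (\<integral>z. (((fst z - m)\<^sup>2 - (a - m)\<^sup>2) * ((snd z - n)\<^sup>2 - (b - n)\<^sup>2)) / 4 \<partial>\<rho>)"
      unfolding s2(2)[OF R, symmetric]
    proof (rule integral_cong_AE)
      show "AE z in \<rho>. (LBINT u. (u - m) * indicat_real {a..a'} u * indicat_real {..<fst z} u) *
          (LBINT v. (v - n) * indicat_real {b..b'} v * indicat_real {..<snd z} v) =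
          ((fst z - m)\<^sup>2 - (a - m)\<^sup>2) * ((snd z - n)\<^sup>2 - (b - n)\<^sup>2) / 4"
        using AE_coupling[OF r] by eventually_elim (simp add: integral_interval_below)
    qed (intro borel_measurable_integrable s2(3)[OF R] coupling_integrable[OF r] continuous_intros; simp)+
    also have "\<dots> = (\<integral>z. ((fst z - m)\<^sup>2 - (a - m)\<^sup>2) * ((snd z - n)\<^sup>2 - (b - n)\<^sup>2) \<partial>\<rho>) / 4"
      by (rule integral_divide_zero)
    also have "(\<integral>z. ((fst z - m)\<^sup>2 - (a - m)\<^sup>2) * ((snd z - n)\<^sup>2 - (b - n)\<^sup>2) \<partial>\<rho>) =
        (\<integral>z. (fst z - m)\<^sup>2 * (snd z - n)\<^sup>2 \<partial>\<rho>) - (b - n)\<^sup>2 * (\<integral>x. (x - m)\<^sup>2 \<partial>\<mu>)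
        - (a - m)\<^sup>2 * (\<integral>y. (y - n)\<^sup>2 \<partial>\<nu>) + (a - m)\<^sup>2 * (b - n)\<^sup>2"
      by (rule integral_coupling_shift[OF r]) (intro continuous_intros)+
    finally show ?thesis by simp
  qed
  show ?I1 ?I2
    unfolding right_diff_distrib
    by (intro Bochner_Integration.integrable_diff s1(1) s2(1) P)+
  let ?f = "\<lambda>w. indicator {a..a'} (fst w) * indicator {b..b'} (snd w) :: real"
  have "(\<integral>w. ?f w * (joint_survival \<pi>0 (fst w) (snd w) - joint_survival \<pi> (fst w) (snd w)) \<partial>lborel) =
      (\<integral>w. ?f w * joint_survival \<pi>0 (fst w) (snd w) - ?f w * joint_survival \<pi> (fst w) (snd w) \<partial>lborel)"
    by (simp only: right_diff_distrib)
  also have "\<dots> = (\<integral>w. ?f w * joint_survival \<pi>0 (fst w) (snd w) \<partial>lborel) - (\<integral>w. ?f w * joint_survival \<pi> (fst w) (snd w) \<partial>lborel)"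
    by (intro Bochner_Integration.integral_diff s1(1) P)
  finally show ?E1 using J1[OF c] J1[OF c0] by linarith
  let ?g = "\<lambda>w. ((fst w - m) * indicator {a..a'} (fst w)) * ((snd w - n) * indicator {b..b'} (snd w)) :: real"
  have "(\<integral>w. ?g w * (joint_survival \<pi>0 (fst w) (snd w) - joint_survival \<pi> (fst w) (snd w)) \<partial>lborel) =
      (\<integral>w. ?g w * joint_survival \<pi>0 (fst w) (snd w) - ?g w * joint_survival \<pi> (fst w) (snd w) \<partial>lborel)"
    by (simp only: right_diff_distrib)
  also have "\<dots> = (\<integral>w. ?g w * joint_survival \<pi>0 (fst w) (snd w) \<partial>lborel) - (\<integral>w. ?g w * joint_survival \<pi> (fst w) (snd w) \<partial>lborel)"
    by (intro Bochner_Integration.integral_diff s2(1) P)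
  finally show ?E2 using J2[OF c] J2[OF c0] by linarith
qed

text \<open>By Hoeffding's identity the nonnegative difference of the survival functions has
  integral zero, so they agree almost everywhere; monotonicity and continuity from the upper right
  upgrade this to every point. The uniqueness of the optimal plan rests on this.\<close>

lemma comonotone_covariance_unique:
  assumes c0: "comonotone_coupling \<mu> \<nu> \<pi>0" and c: "\<pi> \<in> couplings \<mu> \<nu>"
    and eq: "(\<integral>z. (fst z - m) * (snd z - n) \<partial>\<pi>) = (\<integral>z. (fst z - m) * (snd z - n) \<partial>\<pi>0)"
  shows "\<pi> = \<pi>0"
proof -
  have c0': "\<pi>0 \<in> couplings \<mu> \<nu>" using c0 by (simp add: comonotone_coupling_def)
  interpret P: prob_space \<pi> using c by (simp add: couplings_def)
  interpret P0: prob_space \<pi>0 using c0' by (simp add: couplings_def)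
  have "joint_survival \<pi> u v = joint_survival \<pi>0 u v" for u v
  proof (rule antisym[OF joint_survival_le_comonotone[OF c0 c]])
    let ?D = "\<lambda>w. joint_survival \<pi>0 (fst w) (snd w) - joint_survival \<pi> (fst w) (snd w)"
    \<comment> \<open>The intervals are enlarged so that the unit square to the upper right of
      \<open>(u, v)\<close> lies inside the region of integration.\<close>
    have ae_mu: "AE x in \<mu>. x \<in> {min a u..max a' (u+1)}"
      using mu_supp by eventually_elim (auto simp: min_def max_def)
    have ae_nu: "AE x in \<nu>. x \<in> {min b v..max b' (v+1)}"
      using nu_supp by eventually_elim (auto simp: min_def max_def)
    interpret B: bounded_marginals \<mu> \<nu> "min a u" "max a' (u+1)" "min b v" "max b' (v+1)"
      by unfold_locales (rule ae_mu ae_nu)+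
    note sd = B.survival_difference(1)[OF c c0'] B.survival_difference(2)[OF c c0', of m n]
    have "AE w in lborel. indicator {min a u..max a' (u+1)} (fst w) * indicator {min b v..max b' (v+1)} (snd w) * ?D w = 0"
    proof (subst integral_nonneg_eq_0_iff_AE[OF sd(1), symmetric])
      show "AE w in lborel. 0 \<le> indicator {min a u..max a' (u+1)} (fst w) * indicator {min b v..max b' (v+1)} (snd w) * ?D w"
        using joint_survival_le_comonotone[OF c0 c] by simp
    qed (use sd(2) eq in simp)
    then have ae: "AE w in lborel. w \<in> {u<..<u+1} \<times> {v<..<v+1} \<longrightarrow> ?D w = 0"
      by eventually_elim (auto simp: indicator_def split: if_splits)
    \<comment> \<open>The small square has positive Lebesgue measure, so it contains a point
      \<open>(s, r)\<close> where the two survival functions agree. Monotonicity then compares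
      \<open>\<pi>0\<close> at its upper corner with \<pi> at its lower corner.\<close>
    have key: "joint_survival \<pi>0 (u + 1 / Suc k) (v + 1 / Suc k) \<le> joint_survival \<pi> u v" for k
    proof -
      let ?S = "{u<..<u + 1 / Suc k} \<times> {v<..<v + 1 / Suc k}"
      have "\<exists>w \<in> ?S. ?D w = 0"
      proof (rule ccontr)
        assume no: "\<not> (\<exists>w \<in> ?S. ?D w = 0)"
        have "1 / real (Suc k) \<le> 1" by simp
        then have "?S \<subseteq> {u<..<u+1} \<times> {v<..<v+1}"
          by (intro Sigma_mono subsetI; simp only: greaterThanLessThan_iff) linarith+
        with no have "AE w in lborel. w \<notin> ?S"
          using ae by (auto elim!: eventually_mono)
        moreover have "?S = box (u, v) (u + 1 / Suc k, v + 1 / Suc k)"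
          by (auto simp: box_def Basis_prod_def)
        ultimately have "AE w in lborel. w \<notin> box (u, v) (u + 1 / Suc k, v + 1 / Suc k)" by simp
        then have "emeasure lborel (box (u, v) (u + 1 / Suc k, v + 1 / Suc k)) = 0"
          by (subst (asm) AE_iff_measurable[OF _ refl]) auto
        then show False by (simp add: emeasure_lborel_box_eq Basis_prod_def)
      qed
      then obtain s r where sr: "s \<in> {u<..<u + 1 / Suc k}" "r \<in> {v<..<v + 1 / Suc k}"
        "joint_survival \<pi>0 s r = joint_survival \<pi> s r" by auto
      have "joint_survival \<pi>0 (u + 1 / Suc k) (v + 1 / Suc k) \<le> joint_survival \<pi>0 s r"
        unfolding joint_survival_def using sr
        by (intro P0.finite_measure_mono sets_coupling_Times[OF c0']) auto
      also have "\<dots> \<le> joint_survival \<pi> u v"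
        unfolding sr(3) unfolding joint_survival_def using sr
        by (intro P.finite_measure_mono sets_coupling_Times[OF c]) auto
      finally show ?thesis .
    qed
    \<comment> \<open>Continuity from below: these quadrants increase to the open quadrant at
      \<open>(u, v)\<close>.\<close>
    let ?A = "\<lambda>k. {u + 1 / real (Suc k)<..} \<times> {v + 1 / real (Suc k)<..}"
    have "(\<lambda>k. measure \<pi>0 (?A k)) \<longlonglongrightarrow> measure \<pi>0 (\<Union>k. ?A k)"
    proof (rule P0.finite_Lim_measure_incseq)
      show "range ?A \<subseteq> sets \<pi>0" by (auto intro!: sets_coupling_Times[OF c0'])
      show "incseq ?A"
      proof (rule incseq_SucI)
        fix k
        have "1 / real (Suc (Suc k)) \<le> 1 / real (Suc k)" by (simp add: field_simps)
        then show "?A k \<subseteq> ?A (Suc k)" by (intro Sigma_mono) auto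
      qed
    qed
    moreover have "(\<Union>k. ?A k) = {u<..} \<times> {v<..}"
    proof safe
      fix x y k assume "u + 1 / real (Suc k) < x" "v + 1 / real (Suc k) < y"
      moreover have "1 / real (Suc k) > 0" by simp
      ultimately show "u < x" "v < y" by linarith+
    next
      fix x y assume "u < x" "v < y"
      then obtain k where "inverse (real (Suc k)) < min (x - u) (y - v)"
        using reals_Archimedean[of "min (x - u) (y - v)"] by auto
      then have "(x, y) \<in> ?A k" by (simp add: inverse_eq_divide algebra_simps)
      then show "(x, y) \<in> (\<Union>k. ?A k)" by blast
    qed
    ultimately show "joint_survival \<pi>0 u v \<le> joint_survival \<pi> u v"
      using key by (intro LIMSEQ_le_const2[of _ "joint_survival \<pi>0 u v"]) (auto simp: joint_survival_def)
  qed
  then show ?thesis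
    using c c0' by (intro prob_eqI_joint_survival) (auto simp: couplings_def)
qed

section \<open>Reduction of the cost to a gain functional\<close>

abbreviation "mean_mu \<equiv> \<integral>x. x \<partial>\<mu>"
abbreviation "mean_nu \<equiv> \<integral>y. y \<partial>\<nu>"

definition gain :: "(real \<times> real) measure \<Rightarrow> real" where
  "gain \<pi> = (\<integral>z. (fst z - mean_mu)\<^sup>2 * (snd z - mean_nu)\<^sup>2 \<partial>\<pi>) +
    2 * (\<integral>z. (fst z - mean_mu) * (snd z - mean_nu) \<partial>\<pi>)\<^sup>2"

text \<open>After expansion into mixed moments, centring kills the first moments, so only
  \<open>M 2 2\<close> and the square of \<open>M 1 1\<close> depend on the coupling. The
  nonnegativity clause matters because \<open>ennreal\<close> truncates at 0: it lets a strict
  inequality of gains become one of costs.\<close>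

lemma gw_cost_eq_gain:
  "\<exists>C. \<forall>\<pi> \<in> couplings \<mu> \<nu>. gw_cost \<pi> = ennreal (C - 4 * gain \<pi>) \<and> 0 \<le> C - 4 * gain \<pi>"
proof -
  define m n where "m = mean_mu" and "n = mean_nu"
  define C where "C = 2 * (\<integral>x. (x - m)^4 \<partial>\<mu>) + 2 * (\<integral>y. (y - n)^4 \<partial>\<nu>) + 6 * (\<integral>x. (x - m)^2 \<partial>\<mu>)^2
    + 6 * (\<integral>y. (y - n)^2 \<partial>\<nu>)^2 - 4 * (\<integral>x. (x - m)^2 \<partial>\<mu>) * (\<integral>y. (y - n)^2 \<partial>\<nu>)"
  have "gw_cost \<pi> = ennreal (C - 4 * gain \<pi>) \<and> 0 \<le> C - 4 * gain \<pi>" if c: "\<pi> \<in> couplings \<mu> \<nu>" for \<pi>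
  proof -
    interpret prob_space \<pi> using c by (simp add: couplings_def)
    define M where "M i j = (\<integral>z. (fst z - m)^i * (snd z - n)^j \<partial>\<pi>)" for i j :: nat
    have int: "integrable \<pi> (\<lambda>z. (fst z - m)^i * (snd z - n)^j)" for i j
      by (intro coupling_integrable[OF c] continuous_intros)
    \<comment> \<open>The inner integral when the outer point has centred coordinates
      \<open>(p, q)\<close>, with the first moments already set to 0 and \<open>M 0 0\<close> to
      1.\<close>
    define F where "F p q = M 4 0 - 4 * p * M 3 0 + 6 * p^2 * M 2 0 + p^4
      + M 0 4 - 4 * q * M 0 3 + 6 * q^2 * M 0 2 + q^4
      - 2 * (M 2 2 - 2 * q * M 2 1 + q^2 * M 2 0 - 2 * p * M 1 2 + 4 * p * q * M 1 1 + p^2 * M 0 2 + p^2 * q^2)" for p q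
    have M10: "M 1 0 = 0"
    proof -
      have "M 1 0 = (\<integral>x. x - m \<partial>\<mu>)"
        using integral_coupling_marginal(1)[OF c, of "\<lambda>x. x - m"] by (simp add: M_def continuous_intros)
      also have "\<dots> = (\<integral>z. fst z - m \<partial>\<pi>)" using integral_coupling_marginal(1)[OF c, of "\<lambda>x. x - m"] by (simp add: continuous_intros)
      also have "\<dots> = (\<integral>z. fst z \<partial>\<pi>) - m"
        using coupling_integrable[OF c, of fst] by (simp add: prob_space continuous_on_fst continuous_on_id)
      also have "\<dots> = 0" using integral_coupling_marginal(1)[OF c, of "\<lambda>x. x"] by (simp add: m_def continuous_on_id)
      finally show ?thesis .
    qed
    have M01: "M 0 1 = 0"
    proof -
      have "M 0 1 = (\<integral>x. x - n \<partial>\<nu>)"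
        using integral_coupling_marginal(2)[OF c, of "\<lambda>x. x - n"] by (simp add: M_def continuous_intros)
      also have "\<dots> = (\<integral>z. snd z - n \<partial>\<pi>)" using integral_coupling_marginal(2)[OF c, of "\<lambda>x. x - n"] by (simp add: continuous_intros)
      also have "\<dots> = (\<integral>z. snd z \<partial>\<pi>) - n"
        using coupling_integrable[OF c, of snd] by (simp add: prob_space continuous_on_snd continuous_on_id)
      also have "\<dots> = 0" using integral_coupling_marginal(2)[OF c, of "\<lambda>x. x"] by (simp add: n_def continuous_on_id)
      finally show ?thesis .
    qed
    let ?X = "\<lambda>z::real\<times>real. fst z - m" and ?Y = "\<lambda>z::real\<times>real. snd z - n"
    let ?T = "\<lambda>i j z. (fst z - m)^i * (snd z - n)^j"
    have inner: "(\<integral>z. ((?X z - p)\<^sup>2 - (?Y z - q)\<^sup>2)\<^sup>2 \<partial>\<pi>) = F p q" for p q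
    proof -
      \<comment> \<open>Constants are carried as multiples of \<open>?T 0 0 z\<close>, so that every
        summand is a monomial whose integral is some \<open>M i j\<close>.\<close>
      have "((?X z - p)\<^sup>2 - (?Y z - q)\<^sup>2)\<^sup>2 = ?T 4 0 z - 4 * p * ?T 3 0 z + 6 * p^2 * ?T 2 0 z - 4 * p^3 * ?T 1 0 z + p^4 * ?T 0 0 z
        + ?T 0 4 z - 4 * q * ?T 0 3 z + 6 * q^2 * ?T 0 2 z - 4 * q^3 * ?T 0 1 z + q^4 * ?T 0 0 z
        - 2 * (?T 2 2 z - 2 * q * ?T 2 1 z + q^2 * ?T 2 0 z - 2 * p * ?T 1 2 z + 4 * p * q * ?T 1 1 z - 2 * p * q^2 * ?T 1 0 z
          + p^2 * ?T 0 2 z - 2 * p^2 * q * ?T 0 1 z + p^2 * q^2 * ?T 0 0 z)" for z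
        by (simp add: power2_eq_square power3_eq_cube power4_eq_xxxx) algebra
      then have "(\<integral>z. ((?X z - p)\<^sup>2 - (?Y z - q)\<^sup>2)\<^sup>2 \<partial>\<pi>) = M 4 0 - 4 * p * M 3 0 + 6 * p^2 * M 2 0 - 4 * p^3 * M 1 0 + p^4 * M 0 0
        + M 0 4 - 4 * q * M 0 3 + 6 * q^2 * M 0 2 - 4 * q^3 * M 0 1 + q^4 * M 0 0
        - 2 * (M 2 2 - 2 * q * M 2 1 + q^2 * M 2 0 - 2 * p * M 1 2 + 4 * p * q * M 1 1 - 2 * p * q^2 * M 1 0
          + p^2 * M 0 2 - 2 * p^2 * q * M 0 1 + p^2 * q^2 * M 0 0)"
        by (simp only: M_def Bochner_Integration.integral_add Bochner_Integration.integral_diff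
          Bochner_Integration.integrable_add Bochner_Integration.integrable_diff integrable_mult_right
          Bochner_Integration.integral_mult_right_zero int)
      moreover have "M 0 0 = 1" by (simp add: M_def prob_space)
      ultimately show ?thesis by (simp add: F_def M10[simplified] M01[simplified])
    qed
    have outer: "(\<integral>z. F (?X z) (?Y z) \<partial>\<pi>) = C - 4 * gain \<pi>"
    proof -
      have "F (?X z) (?Y z) = M 4 0 * ?T 0 0 z - 4 * M 3 0 * ?T 1 0 z + 6 * M 2 0 * ?T 2 0 z + ?T 4 0 z
        + M 0 4 * ?T 0 0 z - 4 * M 0 3 * ?T 0 1 z + 6 * M 0 2 * ?T 0 2 z + ?T 0 4 z
        - 2 * (M 2 2 * ?T 0 0 z - 2 * M 2 1 * ?T 0 1 z + M 2 0 * ?T 0 2 z - 2 * M 1 2 * ?T 1 0 z + 4 * M 1 1 * ?T 1 1 z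
          + M 0 2 * ?T 2 0 z + ?T 2 2 z)" for z
        by (simp only: F_def power_0 power_one_right mult_1_left mult_1_right mult_ac)
      then have "(\<integral>z. F (?X z) (?Y z) \<partial>\<pi>) = M 4 0 * M 0 0 - 4 * M 3 0 * M 1 0 + 6 * M 2 0 * M 2 0 + M 4 0
        + M 0 4 * M 0 0 - 4 * M 0 3 * M 0 1 + 6 * M 0 2 * M 0 2 + M 0 4
        - 2 * (M 2 2 * M 0 0 - 2 * M 2 1 * M 0 1 + M 2 0 * M 0 2 - 2 * M 1 2 * M 1 0 + 4 * M 1 1 * M 1 1
          + M 0 2 * M 2 0 + M 2 2)"
        by (simp only: M_def[symmetric] Bochner_Integration.integral_add Bochner_Integration.integral_diff
          Bochner_Integration.integrable_add Bochner_Integration.integrable_diff integrable_mult_right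
          Bochner_Integration.integral_mult_right_zero int)
      moreover have "M 0 0 = 1" by (simp add: M_def prob_space)
      moreover have "gain \<pi> = M 2 2 + 2 * M 1 1 * M 1 1"
        by (simp add: gain_def M_def m_def n_def power2_eq_square)
      moreover have "M i 0 = (\<integral>x. (x - m)^i \<partial>\<mu>)" "M 0 i = (\<integral>y. (y - n)^i \<partial>\<nu>)" for i
        using integral_coupling_marginal(1)[OF c, of "\<lambda>x. (x - m)^i"] integral_coupling_marginal(2)[OF c, of "\<lambda>x. (x - n)^i"]
        by (simp_all add: M_def continuous_intros)
      then have "C = 2 * M 4 0 + 2 * M 0 4 + 6 * (M 2 0)^2 + 6 * (M 0 2)^2 - 4 * M 2 0 * M 0 2"
        by (simp add: C_def)
      ultimately show ?thesis by (simp add: M10[simplified] M01[simplified] power2_eq_square)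
    qed
    have nn: "0 \<le> F p q" for p q unfolding inner[symmetric] by simp
    have "gw_cost \<pi> = (\<integral>\<^sup>+ z'. (\<integral>\<^sup>+ z. ennreal (((?X z - ?X z')\<^sup>2 - (?Y z - ?Y z')\<^sup>2)\<^sup>2) \<partial>\<pi>) \<partial>\<pi>)"
      by (simp add: gw_cost_def case_prod_unfold)
    also have "\<dots> = (\<integral>\<^sup>+ z'. ennreal (F (?X z') (?Y z')) \<partial>\<pi>)"
      unfolding inner[symmetric]
      by (intro nn_integral_cong nn_integral_eq_integral coupling_integrable[OF c] continuous_intros) auto
    also have "\<dots> = ennreal (\<integral>z. F (?X z) (?Y z) \<partial>\<pi>)"
    proof (rule nn_integral_eq_integral)
      show "integrable \<pi> (\<lambda>z. F (?X z) (?Y z))"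
        unfolding F_def by (intro coupling_integrable[OF c] continuous_intros)
    qed (simp add: nn)
    finally have "gw_cost \<pi> = ennreal (C - 4 * gain \<pi>)" unfolding outer .
    moreover have "0 \<le> C - 4 * gain \<pi>"
      unfolding outer[symmetric] by (intro Bochner_Integration.integral_nonneg) (simp add: nn)
    ultimately show ?thesis by blast
  qed
  then show ?thesis by blast
qed

end

subsection \<open>Two clusters\<close>

text \<open>On the clusters \<open>x\<close> lies between the step function
  \<open>a + K * indicator {a+R<..} x\<close> and the same function plus \<open>R\<close>.\<close>

lemma two_cluster_mean:
  fixes \<mu> :: "real measure" and a R K t :: real
  assumes "real_distribution \<mu>" and supp: "AE x in \<mu>. x \<in> {a..a+R} \<union> {a+K..a+K+R}"
    and t: "measure \<mu> {a+R<..} = t" and "0 \<le> R" "R < K"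
  shows "a + K * t \<le> (\<integral>x. x \<partial>\<mu>)" "(\<integral>x. x \<partial>\<mu>) \<le> a + K * t + R"
proof -
  interpret real_distribution \<mu> by fact
  have [measurable]: "{a+R<..} \<in> sets \<mu>" by simp
  have iI: "integrable \<mu> (\<lambda>x. a + K * indicator {a+R<..} x)"
    by (intro integrable_const_bound[where B="\<bar>a\<bar> + \<bar>K\<bar>"]) (auto simp: indicator_def)
  have pu: "prob UNIV = 1" using prob_space by simp
  have ii: "integrable \<mu> (indicator {a+R<..} :: real \<Rightarrow> real)"
    by (auto intro!: integrable_real_indicator simp: emeasure_eq_measure)
  have I: "(\<integral>x. a + K * indicator {a+R<..} x \<partial>\<mu>) = a + K * t"
    using t ii by (simp add: pu)
  have iX: "integrable \<mu> (\<lambda>x. x)"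
  proof (rule integrable_const_bound)
    show "AE x in \<mu>. norm x \<le> \<bar>a\<bar> + K + R"
      using supp by eventually_elim (use assms in auto)
  qed simp
  have "(\<integral>x. a + K * indicator {a+R<..} x \<partial>\<mu>) \<le> (\<integral>x. x \<partial>\<mu>)"
    by (rule integral_mono_AE[OF iI iX]) (use supp in eventually_elim, use assms in \<open>auto simp: indicator_def\<close>)
  then show "a + K * t \<le> (\<integral>x. x \<partial>\<mu>)" using I by simp
  have "(\<integral>x. x \<partial>\<mu>) \<le> (\<integral>x. (a + K * indicator {a+R<..} x) + R \<partial>\<mu>)"
    by (rule integral_mono_AE[OF iX]) (use iI in simp, use supp in eventually_elim, use assms in \<open>auto simp: indicator_def\<close>)
  also have "\<dots> = a + K * t + R"
    using I by (subst Bochner_Integration.integral_add[OF iI]) (auto simp: pu)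
  finally show "(\<integral>x. x \<partial>\<mu>) \<le> a + K * t + R" .
qed

text \<open>The base points \<open>a\<close> and \<open>b\<close> are independent because reflecting
  \<nu> moves \<open>b\<close> to \<open>- (b + K + R)\<close>. The bound \<open>1 \<le> R\<close>
  lets additive constants be absorbed into multiples of \<open>K * R\<close>.\<close>

locale two_clusters =
  fixes \<mu> \<nu> :: "real measure" and a b R K t :: real
  assumes mu: "real_distribution \<mu>" and nu: "real_distribution \<nu>"
    and mu_clusters: "AE x in \<mu>. x \<in> {a..a+R} \<union> {a+K..a+K+R}"
    and nu_clusters: "AE y in \<nu>. y \<in> {b..b+R} \<union> {b+K..b+K+R}"
    and mu_upper: "measure \<mu> {a+R<..} = t" and nu_upper: "measure \<nu> {b+R<..} = t"
    and R: "1 \<le> R" and K: "R < K" and t: "0 < t" "t < 1"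
begin

sublocale bounded_marginals \<mu> \<nu> a "a+K+R" b "b+K+R"
proof (rule bounded_marginals.intro[OF mu nu])
  show "AE x in \<mu>. x \<in> {a..a+K+R}" using mu_clusters by eventually_elim (use R K in auto)
  show "AE y in \<nu>. y \<in> {b..b+K+R}" using nu_clusters by eventually_elim (use R K in auto)
qed

lemma AE_clusters:
  assumes c: "\<pi> \<in> couplings \<mu> \<nu>"
  shows "AE z in \<pi>. fst z \<in> {a..a+R} \<union> {a+K..a+K+R} \<and> snd z \<in> {b..b+R} \<union> {b+K..b+K+R}"
proof -
  have "AE x in distr \<pi> borel fst. x \<in> {a..a+R} \<union> {a+K..a+K+R}"
      "AE x in distr \<pi> borel snd. x \<in> {b..b+R} \<union> {b+K..b+K+R}"
    using c mu_clusters nu_clusters by (auto simp: couplings_def)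
  then have "AE z in \<pi>. fst z \<in> {a..a+R} \<union> {a+K..a+K+R}" "AE z in \<pi>. snd z \<in> {b..b+R} \<union> {b+K..b+K+R}"
    using measurable_coupling[OF c] by (simp_all add: AE_distr_iff)
  then show ?thesis by eventually_elim simp
qed

section \<open>Mass exchanged between the clusters\<close>

definition cross_mass :: "(real \<times> real) measure \<Rightarrow> real" where
  "cross_mass \<pi> = t - joint_survival \<pi> (a+R) (b+R)"

text \<open>Both upper clusters have mass \<open>t\<close>, so what the upper-upper block lacks is
  missing equally along its row and its column.\<close>

lemma cross_mass_eq:
  assumes c: "\<pi> \<in> couplings \<mu> \<nu>"
  shows "cross_mass \<pi> = measure \<pi> ({..a+R} \<times> {b+R<..})"
    and "cross_mass \<pi> = measure \<pi> ({a+R<..} \<times> {..b+R})"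
proof -
  interpret prob_space \<pi> using c by (simp add: couplings_def)
  note S = sets_coupling_Times[OF c]
  have "measure \<pi> (UNIV \<times> {b+R<..}) = measure \<pi> ({..a+R} \<times> {b+R<..}) + measure \<pi> ({a+R<..} \<times> {b+R<..})"
    by (subst finite_measure_Union[symmetric]) (auto intro!: S arg_cong[where f="measure \<pi>"])
  then show "cross_mass \<pi> = measure \<pi> ({..a+R} \<times> {b+R<..})"
    using coupling_marginal(2)[OF c, of "{b+R<..}"] nu_upper unfolding cross_mass_def joint_survival_def by simp
  have "measure \<pi> ({a+R<..} \<times> UNIV) = measure \<pi> ({a+R<..} \<times> {..b+R}) + measure \<pi> ({a+R<..} \<times> {b+R<..})"
    by (subst finite_measure_Union[symmetric]) (auto intro!: S arg_cong[where f="measure \<pi>"])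
  then show "cross_mass \<pi> = measure \<pi> ({a+R<..} \<times> {..b+R})"
    using coupling_marginal(1)[OF c, of "{a+R<..}"] mu_upper unfolding cross_mass_def joint_survival_def by simp
qed

lemma cross_mass_bounds:
  assumes c: "\<pi> \<in> couplings \<mu> \<nu>"
  shows "0 \<le> cross_mass \<pi>" "cross_mass \<pi> \<le> t" "cross_mass \<pi> \<le> 1 - t"
proof -
  interpret prob_space \<pi> using c by (simp add: couplings_def)
  note S = sets_coupling_Times[OF c]
  show "0 \<le> cross_mass \<pi>" unfolding cross_mass_eq(1)[OF c] by simp
  show "cross_mass \<pi> \<le> t" by (simp add: cross_mass_def joint_survival_def)
  \<comment> \<open>Mass sent upwards starts in the lower cluster of \<mu>, hence is disjoint from
    the mass \<open>t\<close> starting in the upper one.\<close>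
  have "measure \<pi> ({..a+R} \<times> {b+R<..}) + measure \<pi> ({a+R<..} \<times> UNIV) = measure \<pi> ({..a+R} \<times> {b+R<..} \<union> {a+R<..} \<times> UNIV)"
    by (subst finite_measure_Union) (auto intro!: S)
  also have "\<dots> \<le> 1" by simp
  finally show "cross_mass \<pi> \<le> 1 - t"
    using coupling_marginal(1)[OF c, of "{a+R<..}"] mu_upper cross_mass_eq(1)[OF c] by simp
qed

text \<open>Replace each centred coordinate by \<open>K\<close> times its centred cluster indicator.
  With \<open>p\<close> the cross mass, the product of these indicators has mean
  \<open>t - p - t\<^sup>2\<close>; the two mixed error terms cost at most \<open>K * R\<close>
  each, the product of the errors at most \<open>R\<^sup>2\<close>.\<close>

lemma covariance_ge:
  assumes c: "\<pi> \<in> couplings \<mu> \<nu>"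
  shows "K\<^sup>2 * (t - t\<^sup>2 - cross_mass \<pi>) - 2 * K * R - R\<^sup>2 \<le> (\<integral>z. (fst z - mean_mu) * (snd z - mean_nu) \<partial>\<pi>)"
proof -
  interpret prob_space \<pi> using c by (simp add: couplings_def)
  have sp: "space \<pi> = UNIV" using c sets_eq_imp_space_eq[of \<pi> borel] by (auto simp: couplings_def)
  note S = sets_coupling_Times[OF c]
  let ?A = "{a+R<..}" and ?B = "{b+R<..}"
  let ?f = "\<lambda>z. K\<^sup>2 * (indicator (?A \<times> ?B) z - t * indicator (?A \<times> UNIV) z - t * indicator (UNIV \<times> ?B) z + t\<^sup>2) - 2 * K * R - R\<^sup>2 :: real"
  have ii: "integrable \<pi> (indicator (?A \<times> ?B) :: _ \<Rightarrow> real)" "integrable \<pi> (indicator (?A \<times> UNIV) :: _ \<Rightarrow> real)"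
      "integrable \<pi> (indicator (UNIV \<times> ?B) :: _ \<Rightarrow> real)"
    by (auto intro!: integrable_real_indicator S simp: emeasure_eq_measure)
  have "K\<^sup>2 * (t - t\<^sup>2 - cross_mass \<pi>) - 2 * K * R - R\<^sup>2 = (\<integral>z. ?f z \<partial>\<pi>)"
  proof -
    have "measure \<pi> (?A \<times> UNIV) = t" "measure \<pi> (UNIV \<times> ?B) = t"
      using coupling_marginal(1)[OF c, of ?A] coupling_marginal(2)[OF c, of ?B] mu_upper nu_upper by simp_all
    then have "(\<integral>z. ?f z \<partial>\<pi>) = K\<^sup>2 * (measure \<pi> (?A \<times> ?B) - t * t - t * t + t\<^sup>2) - 2 * K * R - R\<^sup>2"
      using ii prob_space unfolding sp by (simp add: sp)
    then show ?thesis by (simp add: cross_mass_def joint_survival_def power2_eq_square algebra_simps)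
  qed
  also have "\<dots> \<le> (\<integral>z. (fst z - mean_mu) * (snd z - mean_nu) \<partial>\<pi>)"
  proof (rule integral_mono_AE)
    show "integrable \<pi> ?f" using ii by simp
    show "integrable \<pi> (\<lambda>z. (fst z - mean_mu) * (snd z - mean_nu))"
      by (intro coupling_integrable[OF c] continuous_intros)
    have mm: "a + K * t \<le> mean_mu" "mean_mu \<le> a + K * t + R"
      using two_cluster_mean[OF mu mu_clusters mu_upper] R K by auto
    have mn: "b + K * t \<le> mean_nu" "mean_nu \<le> b + K * t + R"
      using two_cluster_mean[OF nu nu_clusters nu_upper] R K by auto
    show "AE z in \<pi>. ?f z \<le> (fst z - mean_mu) * (snd z - mean_nu)"
      using AE_clusters[OF c]
    proof eventually_elim
      case (elim z)
      define \<epsilon> where "\<epsilon> = (indicator ?A (fst z) :: real)"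
      define \<eta> where "\<eta> = (indicator ?B (snd z) :: real)"
      \<comment> \<open>The deviation within a cluster: a point and the mean are each located up to
        an interval of length \<open>R\<close>, so the difference of the two errors is at most
        \<open>R\<close> in absolute value.\<close>
      define d where "d = fst z - mean_mu - K * (\<epsilon> - t)"
      define e where "e = snd z - mean_nu - K * (\<eta> - t)"
      have "\<bar>d\<bar> \<le> R"
        using elim mm R K by (auto simp: d_def \<epsilon>_def indicator_def algebra_simps abs_le_iff)
      have "\<bar>e\<bar> \<le> R"
        using elim mn R K by (auto simp: e_def \<eta>_def indicator_def algebra_simps abs_le_iff)
      have b1: "\<bar>\<epsilon> - t\<bar> \<le> 1" "\<bar>\<eta> - t\<bar> \<le> 1" using t by (auto simp: \<epsilon>_def \<eta>_def indicator_def)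
      have "\<bar>(\<epsilon> - t) * e\<bar> \<le> 1 * R" "\<bar>(\<eta> - t) * d\<bar> \<le> 1 * R" "\<bar>d * e\<bar> \<le> R * R"
        unfolding abs_mult using b1 \<open>\<bar>d\<bar> \<le> R\<close> \<open>\<bar>e\<bar> \<le> R\<close> by (intro mult_mono; simp)+
      then have "- R \<le> (\<epsilon> - t) * e" "- R \<le> (\<eta> - t) * d" "- (R * R) \<le> d * e" by linarith+
      then have "K * (- R) \<le> K * ((\<epsilon> - t) * e)" "K * (- R) \<le> K * ((\<eta> - t) * d)"
        using R K by (intro mult_left_mono; simp)+
      moreover note \<open>- (R * R) \<le> d * e\<close>
      moreover have "(fst z - mean_mu) * (snd z - mean_nu) = (K * (\<epsilon> - t) + d) * (K * (\<eta> - t) + e)"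
        by (simp add: d_def e_def)
      moreover have "\<dots> = K\<^sup>2 * ((\<epsilon> - t) * (\<eta> - t)) + K * ((\<epsilon> - t) * e) + K * ((\<eta> - t) * d) + d * e"
        by (simp add: power2_eq_square algebra_simps)
      moreover have "indicator (?A \<times> ?B) z - t * indicator (?A \<times> UNIV) z - t * indicator (UNIV \<times> ?B) z + t\<^sup>2 = (\<epsilon> - t) * (\<eta> - t)"
        by (cases z) (auto simp: \<epsilon>_def \<eta>_def indicator_def power2_eq_square algebra_simps)
      ultimately show ?case by (simp add: power2_eq_square)
    qed
  qed
  finally show ?thesis .
qed

text \<open>Bounding \<open>\<pi>0\<close> by one marginal, the deficit is at most the \<pi>-mass of
  a strip such as \<open>{..u} \<times> {v<..}\<close>. Outside the two diagonal blocks the strip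
  can be chosen so that it meets the clusters only in an off-diagonal block.\<close>

lemma survival_deficit_le_cross_mass:
  assumes c0: "\<pi>0 \<in> couplings \<mu> \<nu>" and c: "\<pi> \<in> couplings \<mu> \<nu>"
    and uv: "u < a + K \<and> b + R \<le> v \<or> a + R \<le> u \<and> v < b + K"
  shows "joint_survival \<pi>0 u v - joint_survival \<pi> u v \<le> cross_mass \<pi>"
proof -
  interpret prob_space \<pi> using c by (simp add: couplings_def)
  note S = sets_coupling_Times[OF c]
  from uv show ?thesis
  proof
    assume *: "u < a + K \<and> b + R \<le> v"
    have "measure \<pi> (UNIV \<times> {v<..}) = measure \<pi> ({..u} \<times> {v<..}) + measure \<pi> ({u<..} \<times> {v<..})"
      by (subst finite_measure_Union[symmetric]) (auto intro!: S arg_cong[where f="measure \<pi>"])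
    then have "joint_survival \<pi>0 u v - joint_survival \<pi> u v \<le> measure \<pi> ({..u} \<times> {v<..})"
      using joint_survival_le(2)[OF c0, of u v] coupling_marginal(2)[OF c, of "{v<..}"]
      by (simp add: joint_survival_def)
    also have "\<dots> \<le> measure \<pi> ({..a+R} \<times> {b+R<..})"
    proof (rule finite_measure_mono_AE)
      show "AE z in \<pi>. z \<in> {..u} \<times> {v<..} \<longrightarrow> z \<in> {..a+R} \<times> {b+R<..}"
        using AE_clusters[OF c] by eventually_elim (use * in \<open>auto simp: mem_Times_iff\<close>)
    qed (auto intro!: S)
    finally show ?thesis unfolding cross_mass_eq(1)[OF c] .
  next
    assume *: "a + R \<le> u \<and> v < b + K"
    have "measure \<pi> ({u<..} \<times> UNIV) = measure \<pi> ({u<..} \<times> {..v}) + measure \<pi> ({u<..} \<times> {v<..})"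
      by (subst finite_measure_Union[symmetric]) (auto intro!: S arg_cong[where f="measure \<pi>"])
    then have "joint_survival \<pi>0 u v - joint_survival \<pi> u v \<le> measure \<pi> ({u<..} \<times> {..v})"
      using joint_survival_le(1)[OF c0, of u v] coupling_marginal(1)[OF c, of "{u<..}"]
      by (simp add: joint_survival_def)
    also have "\<dots> \<le> measure \<pi> ({a+R<..} \<times> {..b+R})"
    proof (rule finite_measure_mono_AE)
      show "AE z in \<pi>. z \<in> {u<..} \<times> {..v} \<longrightarrow> z \<in> {a+R<..} \<times> {..b+R}"
        using AE_clusters[OF c] by eventually_elim (use * in \<open>auto simp: mem_Times_iff\<close>)
    qed (auto intro!: S)
    finally show ?thesis unfolding cross_mass_eq(2)[OF c] .
  qed
qed

text \<open>The marginals do not charge the gaps, so moving the corner inside the gap square changes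
  nothing. The right ends are excluded because there may be atoms at \<open>a + K\<close> or
  \<open>b + K\<close>.\<close>

lemma joint_survival_gap:
  assumes c: "\<pi> \<in> couplings \<mu> \<nu>"
    and "a + R \<le> u" "u < a + K" "b + R \<le> v" "v < b + K"
  shows "joint_survival \<pi> u v = t - cross_mass \<pi>"
proof -
  interpret prob_space \<pi> using c by (simp add: couplings_def)
  have "joint_survival \<pi> u v = joint_survival \<pi> (a+R) (b+R)"
    unfolding joint_survival_def
  proof (rule finite_measure_eq_AE)
    show "AE z in \<pi>. (z \<in> {u<..} \<times> {v<..}) = (z \<in> {a+R<..} \<times> {b+R<..})"
      using AE_clusters[OF c] by eventually_elim (use assms in \<open>auto simp: mem_Times_iff\<close>)
  qed (auto intro!: sets_coupling_Times[OF c])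
  then show ?thesis by (simp add: cross_mass_def)
qed

lemma comonotone_cross_mass:
  assumes "comonotone_coupling \<mu> \<nu> \<pi>0"
  shows "cross_mass \<pi>0 = 0"
  using assms mu_upper nu_upper by (simp add: comonotone_coupling_def cross_mass_def)

text \<open>The three upper bounds on \<kappa> keep the leading coefficients of order
  \<open>K\<^sup>2\<close> away from 0: on the gap square, on the lower block and on the upper
  block. The condition \<open>200 * R \<le> K * \<kappa>\<close> makes
  \<open>K\<^sup>2 * \<kappa>\<close> dominate all errors of order \<open>K * R\<close>. The
  covariance surplus on the left is kept in reserve for uniqueness.\<close>

lemma comonotone_gain:
  assumes c0: "comonotone_coupling \<mu> \<nu> \<pi>0" and c: "\<pi> \<in> couplings \<mu> \<nu>"
    and \<kappa>: "0 < \<kappa>" "\<kappa> \<le> 1/4 - cross_mass \<pi> / 2" "\<kappa> \<le> t" "\<kappa> \<le> 1 - t" and K\<kappa>: "200 * R \<le> K * \<kappa>"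
  shows "4 * ((\<integral>z. (fst z - mean_mu) * (snd z - mean_nu) \<partial>\<pi>0) - (\<integral>z. (fst z - mean_mu) * (snd z - mean_nu) \<partial>\<pi>))
    \<le> gain \<pi>0 - gain \<pi>"
proof -
  define m n where "m = mean_mu" and "n = mean_nu"
  define p where "p = cross_mass \<pi>"
  define C0 where "C0 = (\<integral>z. (fst z - m) * (snd z - n) \<partial>\<pi>0)"
  define C1 where "C1 = (\<integral>z. (fst z - m) * (snd z - n) \<partial>\<pi>)"
  \<comment> \<open>Since \<open>C0\<^sup>2 - C1\<^sup>2 = 2 * s * (C0 - C1)\<close>, this
    linearises the quadratic part of the gain.\<close>
  define s where "s = (C0 + C1) / 2"
  define W where "W = 2 * (K + R)\<^sup>2 + 1"
  define D where "D u v = joint_survival \<pi>0 u v - joint_survival \<pi> u v" for u v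
  \<comment> \<open>One unit of \<open>s\<close> is held back: by Hoeffding, 1 integrated against
    \<open>D\<close> over the box is \<open>C0 - C1\<close>, which supplies the surplus in the
    conclusion.\<close>
  define w where "w u v = (u - m) * (v - n) + (s - 1)" for u v
  have c0': "\<pi>0 \<in> couplings \<mu> \<nu>" using c0 by (simp add: comonotone_coupling_def)
  have p: "0 \<le> p" "p \<le> t" "p \<le> 1 - t" using cross_mass_bounds[OF c] by (simp_all add: p_def)
  have m: "a + K * t \<le> m" "m \<le> a + K * t + R"
    using two_cluster_mean[OF mu mu_clusters mu_upper] R K by (auto simp: m_def)
  have n: "b + K * t \<le> n" "n \<le> b + K * t + R"
    using two_cluster_mean[OF nu nu_clusters nu_upper] R K by (auto simp: n_def)
  have "K * \<kappa> \<le> K * (1/4)" using \<kappa> p R K by (intro mult_left_mono) (auto simp: p_def)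
  with K\<kappa> have K800: "800 * R \<le> K" by simp
  have K0: "0 < K" using R K by simp
  have Kt: "0 \<le> K * t" "K * t \<le> K" using t K0 by (auto simp: mult_le_cancel_left1)
  have Kk: "K * \<kappa> \<le> K * t" "K * \<kappa> \<le> K * (1 - t)" using \<kappa> K0 by (auto intro!: mult_left_mono)
  have RK: "R * R \<le> K * R" "1 \<le> K * R" "1 \<le> R * R" 
    using R K800 mult_mono[of 1 K 1 R] mult_mono[of 1 R 1 R] by (auto intro!: mult_right_mono)
  \<comment> \<open>The average of two covariance bounds, with cross masses 0 and \<open>p\<close>;
    hence \<open>p / 2\<close>.\<close>
  have s_ge: "K\<^sup>2 * (t - t\<^sup>2 - p / 2) - 2 * (K * R) - R\<^sup>2 \<le> s"
    using covariance_ge[OF c] covariance_ge[OF c0'] comonotone_cross_mass[OF c0]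
    by (simp add: s_def C0_def C1_def m_def n_def p_def algebra_simps)
  have D_nonneg: "0 \<le> D u v" for u v
    using joint_survival_le_comonotone[OF c0 c] by (simp add: D_def)

  \<comment> \<open>The \<open>t\<^sup>2\<close> of the product cancels the one in the bound on
    \<open>s\<close>, leaving the leading term \<open>K\<^sup>2 * (t - p / 2)\<close>; as
    \<open>p \<le> t\<close>, this is at least \<open>K\<^sup>2 * \<kappa> / 2\<close>.\<close>
  have w_low: "0 \<le> w u v" if "u \<in> {a..a+R}" "v \<in> {b..b+R}" for u v
  proof -
    have "(K * t - R) * (K * t - R) \<le> (m - u) * (n - v)"
      using that m n K\<kappa> Kk R by (intro mult_mono) auto
    moreover have "(K * t - R) * (K * t - R) = K\<^sup>2 * t\<^sup>2 - 2 * (K * t) * R + R * R"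
      by (simp add: power2_eq_square algebra_simps)
    moreover have "(K * t) * R \<le> K * R" using Kt R by (intro mult_right_mono) auto
    moreover have "K * (200 * R) \<le> K * (K * \<kappa>)" using K\<kappa> K0 by (intro mult_left_mono) auto
    moreover have "K\<^sup>2 * \<kappa> \<le> K\<^sup>2 * (2 * (t - p / 2))" using \<kappa> p t by (intro mult_left_mono) auto
    ultimately show ?thesis
      using s_ge RK unfolding w_def by (simp add: power2_eq_square algebra_simps)
  qed
  \<comment> \<open>The same cancellation with
    \<open>(1 - t)\<^sup>2 + t - t\<^sup>2 = 1 - t\<close>, now using
    \<open>p \<le> 1 - t\<close>.\<close>
  have w_high: "0 \<le> w u v" if "a + K \<le> u" "b + K \<le> v" for u v
  proof -
    have "(K * (1 - t) - R) * (K * (1 - t) - R) \<le> (u - m) * (v - n)"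
      using that m n K\<kappa> Kk R by (intro mult_mono) (auto simp: algebra_simps)
    moreover have "(K * (1 - t) - R) * (K * (1 - t) - R) = K\<^sup>2 * (1 - t)\<^sup>2 - 2 * (K * (1 - t)) * R + R * R"
      by (simp add: power2_eq_square algebra_simps)
    moreover have "(K * (1 - t)) * R \<le> K * R" using t K0 R by (intro mult_right_mono) (auto simp: mult_le_cancel_left1)
    moreover have "K * (200 * R) \<le> K * (K * \<kappa>)" using K\<kappa> K0 by (intro mult_left_mono) auto
    moreover have "K\<^sup>2 * \<kappa> \<le> K\<^sup>2 * (2 * (1 - t - p / 2))" using \<kappa> p t by (intro mult_left_mono) auto
    ultimately show ?thesis
      using s_ge RK unfolding w_def by (simp add: power2_eq_square algebra_simps)
  qed
  \<comment> \<open>The product and \<open>s\<close> are each at least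
    \<open>- (K + R)\<^sup>2\<close>, and 1 was subtracted from \<open>s\<close>; this fixes the
    value of \<open>W\<close>.\<close>
  have w_ge: "- W \<le> w u v" if "u \<in> {a..a+K+R}" "v \<in> {b..b+K+R}" for u v
  proof -
    have "\<bar>u - m\<bar> \<le> K + R" "\<bar>v - n\<bar> \<le> K + R" using that m n Kt by auto
    then have "\<bar>(u - m) * (v - n)\<bar> \<le> (K + R) * (K + R)"
      unfolding abs_mult by (intro mult_mono) auto
    moreover have "K\<^sup>2 * (- 1) \<le> K\<^sup>2 * (t - t\<^sup>2 - p / 2)"
    proof (rule mult_left_mono)
      have "t\<^sup>2 \<le> t" using t by (simp add: power2_eq_square mult_le_cancel_left1)
      then show "- 1 \<le> t - t\<^sup>2 - p / 2" using p t by linarith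
    qed simp
    ultimately show ?thesis
      using s_ge unfolding w_def W_def by (simp add: power2_eq_square algebra_simps abs_le_iff)
  qed

  let ?A = "indicator {a..a+K+R} :: real \<Rightarrow> real" and ?B = "indicator {b..b+K+R} :: real \<Rightarrow> real"
  \<comment> \<open>The indicator of the half-open gap, split into two factors in the shape required
    by \<open>integral_interval_below\<close> with \<open>x = a + K\<close>.\<close>
  let ?G = "\<lambda>u. indicator {a+R..a+K} u * indicator {..<a+K} u :: real"
  let ?H = "\<lambda>v. indicator {b+R..b+K} v * indicator {..<b+K} v :: real"
  let ?G1 = "\<lambda>u. (u - m) * indicator {a+R..a+K} u * indicator {..<a+K} u :: real"
  let ?H1 = "\<lambda>v. (v - n) * indicator {b+R..b+K} v * indicator {..<b+K} v :: real"
  define L where "L z = ((fst z - m) * ?A (fst z)) * ((snd z - n) * ?B (snd z)) * D (fst z) (snd z)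
      + (s - 1) * (?A (fst z) * ?B (snd z) * D (fst z) (snd z))" for z :: "real \<times> real"
  \<comment> \<open>The minorant: \<open>p * w\<close> on the gap square and \<open>- p * W\<close>
    on the rest of the box, written as a sum of products of one-variable functions so that its
    integral factorises.\<close>
  define E where "E z = p * (?G1 (fst z) * ?H1 (snd z)) + p * (s - 1 + W) * (?G (fst z) * ?H (snd z))
      - p * W * (?A (fst z) * ?B (snd z))" for z :: "real \<times> real"
  \<comment> \<open>The deficit \<open>D\<close> is exactly \<open>p\<close> on the gap square, where \<open>w\<close> has no fixed sign; on the diagonal
    blocks \<open>w \<ge> 0\<close>; elsewhere \<open>D \<le> p\<close> and \<open>w \<ge> - W\<close>.\<close>
  have EL: "E z \<le> L z" for z
  proof -
    obtain u v where z: "z = (u, v)" by (cases z)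
    have L: "L z = ?A u * ?B v * (w u v * D u v)"
      by (simp add: L_def z w_def algebra_simps)
    have E: "E z = p * ((?G u * ?H v) * (w u v + W) - W * (?A u * ?B v))"
      by (simp add: E_def z w_def algebra_simps)
    have W: "0 \<le> W" by (simp add: W_def)
    then have Wp: "0 \<le> W * p" using p by simp
    show ?thesis
    proof (cases "u \<in> {a..a+K+R} \<and> v \<in> {b..b+K+R}")
      case False
      then have "?G u * ?H v = 0" "?A u * ?B v = 0" using R by (auto simp: indicator_def)
      then show ?thesis unfolding L E by (simp only: mult_zero_left mult_zero_right diff_self order_refl)
    next
      case box: True
      then have AB: "?A u * ?B v = 1" by simp
      show ?thesis
      proof (cases "u \<in> {a+R..<a+K} \<and> v \<in> {b+R..<b+K}")
        case True
        then have "?G u * ?H v = 1" by simp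
        moreover have "D u v = p"
          using True joint_survival_gap[OF c0', of u v] joint_survival_gap[OF c, of u v] comonotone_cross_mass[OF c0]
          by (simp add: D_def p_def)
        ultimately show ?thesis unfolding L E AB by (simp add: algebra_simps)
      next
        case False
        then have E': "E z = - (W * p)" unfolding E AB by (auto simp: indicator_def)
        consider "u \<in> {a..a+R}" "v \<in> {b..b+R}" | "a + K \<le> u" "b + K \<le> v"
          | "u < a + K \<and> b + R \<le> v \<or> a + R \<le> u \<and> v < b + K"
          using box K by force
        then show ?thesis
        proof cases
          case 1
          then have "0 \<le> w u v * D u v" using w_low[of u v] D_nonneg[of u v] by simp
          then show ?thesis using Wp unfolding L E' AB by linarith
        next
          case 2
          then have "0 \<le> w u v * D u v" using w_high[of u v] D_nonneg[of u v] by simp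
          then show ?thesis using Wp unfolding L E' AB by linarith
        next
          case 3
          have "W * D u v \<le> W * p"
            using survival_deficit_le_cross_mass[OF c0' c 3] W by (intro mult_left_mono) (auto simp: D_def p_def)
          moreover have "(- W) * D u v \<le> w u v * D u v"
            using w_ge box D_nonneg by (intro mult_right_mono) auto
          ultimately show ?thesis unfolding L E' AB by simp
        qed
      qed
    qed
  qed
  note i1 = integrable_interval(1) and i2 = integrable_interval(2)
  have ih: "integrable lborel ?G" "integrable lborel ?H" "integrable lborel ?G1" "integrable lborel ?H1"
    by (intro integrable_real_mult_indicator i1 i2; simp)+
  note ip = lborel_integrable_times[OF ih(3,4)] lborel_integrable_times[OF ih(1,2)] lborel_integrable_times[OF i1 i1]
  note sd = survival_difference[OF c c0', folded D_def]
  have intE: "integrable lborel E"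
    unfolding E_def
    by (intro Bochner_Integration.integrable_diff Bochner_Integration.integrable_add integrable_mult_right ip)
  have intL: "integrable lborel L"
    unfolding L_def
    by (intro Bochner_Integration.integrable_add integrable_mult_right sd)
  have valL: "4 * (\<integral>z. L z \<partial>lborel) = (gain \<pi>0 - gain \<pi>) - 4 * (C0 - C1)"
  proof -
    define q0 where "q0 = (\<integral>z. (fst z - m)\<^sup>2 * (snd z - n)\<^sup>2 \<partial>\<pi>0)"
    define q1 where "q1 = (\<integral>z. (fst z - m)\<^sup>2 * (snd z - n)\<^sup>2 \<partial>\<pi>)"
    have "(\<integral>z. L z \<partial>lborel) = (\<integral>z. ((fst z - m) * ?A (fst z)) * ((snd z - n) * ?B (snd z)) * D (fst z) (snd z) \<partial>lborel)
      + (s - 1) * (\<integral>z. ?A (fst z) * ?B (snd z) * D (fst z) (snd z) \<partial>lborel)"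
      unfolding L_def
      by (subst Bochner_Integration.integral_add) (intro integrable_mult_right sd, intro integrable_mult_right sd, simp)
    then have "(\<integral>z. L z \<partial>lborel) = (\<integral>z. ((fst z - m) * ?A (fst z)) * ((snd z - n) * ?B (snd z)) * D (fst z) (snd z) \<partial>lborel)
      + (s - 1) * (C0 - C1)"
      unfolding sd(2)[of m n] C0_def C1_def .
    then have "4 * (\<integral>z. L z \<partial>lborel) = (q0 - q1) + 4 * ((s - 1) * (C0 - C1))"
      unfolding sd(4)[of m n, symmetric] q0_def q1_def by linarith
    moreover have "gain \<pi>0 = q0 + 2 * C0\<^sup>2" "gain \<pi> = q1 + 2 * C1\<^sup>2"
      unfolding gain_def C0_def C1_def q0_def q1_def m_def n_def by simp_all
    ultimately show ?thesis by (simp add: s_def power2_eq_square field_simps)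
  qed
  \<comment> \<open>The midpoint of a gap relative to the mean, that is, the average of
    \<open>u - m\<close> over the gap.\<close>
  define gx where "gx = a + (K + R) / 2 - m"
  define gy where "gy = b + (K + R) / 2 - n"
  have valE: "(\<integral>z. E z \<partial>lborel) = p * ((K - R)\<^sup>2 * (gx * gy + s - 1 + W) - W * (K + R)\<^sup>2)"
  proof -
    have "(\<integral>z. E z \<partial>lborel) = p * (\<integral>z. ?G1 (fst z) * ?H1 (snd z) \<partial>lborel)
       + p * (s - 1 + W) * (\<integral>z. ?G (fst z) * ?H (snd z) \<partial>lborel) - p * W * (\<integral>z. ?A (fst z) * ?B (snd z) \<partial>lborel)"
      unfolding E_def using ip by simp
    also have "(\<integral>z. ?G1 (fst z) * ?H1 (snd z) \<partial>lborel) = ((K - R) * gx) * ((K - R) * gy)"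
    proof -
      have "integral\<^sup>L lborel ?G1 = (K - R) * gx"
        using integral_interval_below(2)[of "a + R" "a + K" "a + K" m] K
        by (simp only: order_refl) (simp add: gx_def power2_eq_square field_simps)
      moreover have "integral\<^sup>L lborel ?H1 = (K - R) * gy"
        using integral_interval_below(2)[of "b + R" "b + K" "b + K" n] K
        by (simp only: order_refl) (simp add: gy_def power2_eq_square field_simps)
      ultimately show ?thesis unfolding lborel_integral_times(2)[OF ih(3,4)] by (simp only:)
    qed
    also have "(\<integral>z. ?G (fst z) * ?H (snd z) \<partial>lborel) = (K - R) * (K - R)"
      unfolding lborel_integral_times(2)[OF ih(1,2)] using K
      by (simp add: integral_interval_below)
    also have "(\<integral>z. ?A (fst z) * ?B (snd z) \<partial>lborel) = (K + R) * (K + R)"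
      unfolding lborel_integral_times(2)[OF i1 i1] using K R by simp
    finally show ?thesis by (simp add: power2_eq_square algebra_simps)
  qed
  have "0 \<le> (K - R)\<^sup>2 * (gx * gy + s - 1 + W) - W * (K + R)\<^sup>2"
  proof -
    \<comment> \<open>The leading part of both \<open>gx\<close> and \<open>gy\<close>; the
      remainders are at most \<open>R / 2\<close> because each mean is known up to an interval of
      length \<open>R\<close>.\<close>
    define h where "h = K * (1/2 - t)"
    define d e where "d = gx - h" and "e = gy - h"
    have "d = a + K * t + R / 2 - m" "e = b + K * t + R / 2 - n"
      by (simp_all add: d_def e_def h_def gx_def gy_def field_simps)
    then have "\<bar>d\<bar> \<le> R / 2" "\<bar>e\<bar> \<le> R / 2"
      using m n by (intro abs_leI; linarith)+
    moreover have "\<bar>h\<bar> \<le> K / 2"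
    proof -
      have "h = K / 2 - K * t" by (simp add: h_def algebra_simps)
      then show ?thesis using Kt by (intro abs_leI; linarith)
    qed
    ultimately have "\<bar>h * (d + e)\<bar> \<le> K / 2 * R" "\<bar>d * e\<bar> \<le> R / 2 * (R / 2)"
      unfolding abs_mult by (intro mult_mono; simp)+
    then have "h * h - K / 2 * R - R * R / 4 \<le> h * h + h * (d + e) + d * e" by (simp add: abs_le_iff)
    also have "\<dots> = gx * gy" by (simp add: d_def e_def algebra_simps)
    finally have "h * h - K / 2 * R - R * R / 4 \<le> gx * gy" .
    \<comment> \<open>The terms in \<open>t\<close> cancel, leaving the coefficient
      \<open>1/4 - p / 2\<close>, which is positive exactly when \<open>p < 1/2\<close>.\<close>
    moreover have "h * h + K\<^sup>2 * (t - t\<^sup>2 - p / 2) = K\<^sup>2 * (1/4 - p / 2)"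
      by (simp add: h_def power2_eq_square algebra_simps)
    moreover have "K * (200 * R) \<le> K * (K * \<kappa>)" using K\<kappa> K0 by (intro mult_left_mono) auto
    moreover have "K\<^sup>2 * \<kappa> \<le> K\<^sup>2 * (1/4 - p / 2)" using \<kappa> by (intro mult_left_mono) (auto simp: p_def)
    ultimately have S: "195 * (K * R) \<le> gx * gy + s - 1"
      using s_ge RK by (simp add: power2_eq_square algebra_simps)
    have KR: "800 * (K * R) \<le> K * K" using mult_left_mono[OF K800, of K] K0 by simp
    have W3: "W \<le> 4 * (K * K)"
      using RK KR unfolding W_def by (simp add: power2_eq_square algebra_simps)
    have half: "K * K / 2 \<le> (K - R)\<^sup>2" using KR RK by (simp add: power2_eq_square algebra_simps)
    \<comment> \<open>\<open>4 * (K * R)\<close> is the area of the box minus that of the gap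
      square, so this is the worst possible loss outside the gap square, up to the factor
      \<open>p\<close>.\<close>
    have "W * (4 * (K * R)) \<le> 4 * (K * K) * (4 * (K * R))"
      using W3 K0 R by (intro mult_right_mono) auto
    also have "\<dots> \<le> K * K / 2 * (195 * (K * R))"
      using K0 R by simp
    also have "\<dots> \<le> (K - R)\<^sup>2 * (gx * gy + s - 1)"
      using half S K0 R by (intro mult_mono) auto
    finally show ?thesis by (simp add: power2_eq_square algebra_simps)
  qed
  then have "0 \<le> (\<integral>z. E z \<partial>lborel)" unfolding valE using p by simp
  also have "\<dots> \<le> (\<integral>z. L z \<partial>lborel)" by (rule integral_mono[OF intE intL]) (rule EL)
  finally show ?thesis using valL unfolding C0_def C1_def m_def n_def by simp
qed

text \<open>The surplus in \<open>comonotone_gain\<close> is nonnegative by Hoeffding's identity and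
  nonzero because equal covariance would force equality of the couplings.\<close>

theorem comonotone_cost_less:
  assumes c0: "comonotone_coupling \<mu> \<nu> \<pi>0" and c: "\<pi> \<in> couplings \<mu> \<nu>" and ne: "\<pi> \<noteq> \<pi>0"
    and \<kappa>: "0 < \<kappa>" "\<kappa> \<le> 1/4 - cross_mass \<pi> / 2" "\<kappa> \<le> t" "\<kappa> \<le> 1 - t" and K\<kappa>: "200 * R \<le> K * \<kappa>"
  shows "gw_cost \<pi>0 < gw_cost \<pi>"
proof -
  let ?C = "\<lambda>\<pi>. \<integral>z. (fst z - mean_mu) * (snd z - mean_nu) \<partial>\<pi>"
  have c0': "\<pi>0 \<in> couplings \<mu> \<nu>" using c0 by (simp add: comonotone_coupling_def)
  have "0 \<le> ?C \<pi>0 - ?C \<pi>"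
    unfolding survival_difference(2)[OF c c0', symmetric]
    using joint_survival_le_comonotone[OF c0 c] by (intro Bochner_Integration.integral_nonneg) simp
  moreover have "?C \<pi> \<noteq> ?C \<pi>0" using comonotone_covariance_unique[OF c0 c] ne by blast
  ultimately have "0 < 4 * (?C \<pi>0 - ?C \<pi>)" by simp
  also note comonotone_gain[OF c0 c \<kappa> K\<kappa>]
  finally have "gain \<pi> < gain \<pi>0" by simp
  with gw_cost_eq_gain c c0' show ?thesis by (auto simp: ennreal_less_iff)
qed

end

subsection \<open>Monotone rearrangements\<close>

abbreviation uniform01 :: "real measure" where
  "uniform01 \<equiv> restrict_space lborel {0<..<1}"

lemma prob_space_uniform01: "prob_space uniform01"
  by (auto simp add: emeasure_restrict_space space_restrict_space intro!: prob_spaceI)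

lemma measurable_uniform01_eq:
  "borel_measurable uniform01 = borel_measurable (restrict_space borel {0<..<1})"
  by (intro measurable_cong_sets sets_restrict_space_cong) auto

lemma distr_uniform01_reflect:
  assumes h: "h \<in> borel_measurable (restrict_space borel {0<..<1::real})"
  shows "distr uniform01 borel (\<lambda>u. h (1 - u)) = (distr uniform01 borel h :: real measure)"
proof (rule measure_eqI)
  have h': "(\<lambda>u. h (1 - u)) \<in> borel_measurable (restrict_space borel {0<..<1::real})"
    by (rule measurable_compose[OF _ h]) (rule measurable_restrict_space3, auto)
  note hm = h[folded measurable_uniform01_eq] h'[folded measurable_uniform01_eq]
  fix B assume "B \<in> sets (distr uniform01 borel (\<lambda>u. h (1 - u)) :: real measure)"
  then have B: "B \<in> sets borel" by simp
  define S where "S = h -` B \<inter> {0<..<1}"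
  have S: "S \<in> sets borel"
    using measurable_sets[OF h B] by (simp add: S_def space_restrict_space sets_restrict_space_iff)
  have S': "(\<lambda>u. h (1 - u)) -` B \<inter> {0<..<1} = (\<lambda>u. 1 - u) -` S" by (auto simp: S_def)
  have lb: "(lborel :: real measure) = distr lborel borel (\<lambda>x. 1 - x)"
    by (subst lborel_real_affine[of "-1" 1]) (simp_all add: density_1)
  have "emeasure (distr uniform01 borel (\<lambda>u. h (1 - u))) B = emeasure lborel ((\<lambda>u. 1 - u) -` S)"
  proof -
    have "(\<lambda>u. 1 - u) -` S \<subseteq> {0<..<1}" by (auto simp: S_def)
    then show ?thesis
      using B hm by (simp add: emeasure_distr space_restrict_space emeasure_restrict_space S')
  qed
  also have "\<dots> = emeasure lborel S"
    by (subst (2) lb) (use S in \<open>simp add: emeasure_distr\<close>)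
  also have "\<dots> = emeasure (distr uniform01 borel h) B"
    using B hm by (simp add: emeasure_distr space_restrict_space emeasure_restrict_space S_def)
  finally show "emeasure (distr uniform01 borel (\<lambda>u. h (1 - u))) B = emeasure (distr uniform01 borel h) B" .
qed simp

lemma mono_on_quantile:
  assumes "real_distribution M"
  shows "mono_on {0<..<1} (quantile M)"
proof -
  interpret cdf_distribution M using assms by (simp add: cdf_distribution_def)
  have "quantile M = (\<lambda>u. Inf {x. u \<le> cdf M x})" by (simp add: quantile_def fun_eq_iff)
  then show ?thesis using mono_I by simp
qed

lemma measurable_borel_fst_snd:
  "fst \<in> borel_measurable (borel :: (real \<times> real) measure)"
  "snd \<in> borel_measurable (borel :: (real \<times> real) measure)"
  by (simp_all add: borel_prod[symmetric])

lemma distr_uniform01_Pair_coupling: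
  assumes f: "f \<in> borel_measurable uniform01" "distr uniform01 borel f = \<mu>"
    and g: "g \<in> borel_measurable uniform01" "distr uniform01 borel g = \<nu>"
  shows "distr uniform01 borel (\<lambda>u. (f u, g u)) \<in> couplings \<mu> \<nu>"
proof -
  have fg: "(\<lambda>u. (f u, g u)) \<in> measurable uniform01 borel"
    using f g by (simp add: borel_prod[symmetric])
  note [measurable] = measurable_borel_fst_snd
  show ?thesis
    using f g fg prob_space.prob_space_distr[OF prob_space_uniform01 fg]
    by (simp add: couplings_def distr_distr o_def)
qed

text \<open>Stated for arbitrary nondecreasing representatives, so that it also covers
  \<open>- quantile \<nu> (1 - u)\<close> without comparing it with the quantile function of the
  reflected measure.\<close>

lemma distr_uniform01_mono_comonotone:
  assumes f: "f \<in> borel_measurable uniform01" "distr uniform01 borel f = \<mu>" "mono_on {0<..<1} f"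
    and g: "g \<in> borel_measurable uniform01" "distr uniform01 borel g = \<nu>" "mono_on {0<..<1} g"
  shows "comonotone_coupling \<mu> \<nu> (distr uniform01 borel (\<lambda>u. (f u, g u)))"
proof -
  interpret prob_space uniform01 by (rule prob_space_uniform01)
  have fg: "(\<lambda>u. (f u, g u)) \<in> measurable uniform01 borel"
    using f g by (simp add: borel_prod[symmetric])
  have "joint_survival (distr uniform01 borel (\<lambda>u. (f u, g u))) x y = min (measure \<mu> {x<..}) (measure \<nu> {y<..})" for x y
  proof -
    define S where "S = {u \<in> {0<..<1}. x < f u}"
    define T where "T = {u \<in> {0<..<1}. y < g u}"
    have S: "f -` {x<..} \<inter> space uniform01 = S" and T: "g -` {y<..} \<inter> space uniform01 = T"
      by (auto simp: S_def T_def space_restrict_space)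
    have sets: "S \<in> sets uniform01" "T \<in> sets uniform01"
      using measurable_sets[OF f(1), of "{x<..}"] measurable_sets[OF g(1), of "{y<..}"] unfolding S T by auto
    have mu: "measure \<mu> {x<..} = prob S" and nu: "measure \<nu> {y<..} = prob T"
      unfolding f(2)[symmetric] g(2)[symmetric] using f(1) g(1) S T by (simp_all add: measure_distr)
    have "{x<..} \<times> {y<..} \<in> sets (borel :: (real \<times> real) measure)"
      by (simp add: borel_prod[symmetric])
    moreover have "(\<lambda>u. (f u, g u)) -` ({x<..} \<times> {y<..}) \<inter> space uniform01 = S \<inter> T"
      by (auto simp: S_def T_def space_restrict_space)
    ultimately have js: "joint_survival (distr uniform01 borel (\<lambda>u. (f u, g u))) x y = prob (S \<inter> T)"
      unfolding joint_survival_def using fg by (simp add: measure_distr)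
    \<comment> \<open>Superlevel sets of monotone functions are nested.\<close>
    have "S \<subseteq> T \<or> T \<subseteq> S"
    proof (rule ccontr)
      assume "\<not> ?thesis"
      then obtain u v where uv: "u \<in> S" "u \<notin> T" "v \<in> T" "v \<notin> S" by blast
      then have "u \<in> {0<..<1}" "v \<in> {0<..<1}" by (auto simp: S_def T_def)
      then show False
        using uv mono_onD[OF f(3), of u v] mono_onD[OF g(3), of v u]
        by (cases "u \<le> v") (auto simp: S_def T_def)
    qed
    then show ?thesis
    proof
      assume "S \<subseteq> T"
      moreover from this have "prob S \<le> prob T" using sets by (intro finite_measure_mono)
      ultimately show ?thesis by (simp add: js mu nu Int_absorb2)
    next
      assume "T \<subseteq> S"
      moreover from this have "prob T \<le> prob S" using sets by (intro finite_measure_mono)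
      ultimately show ?thesis by (simp add: js mu nu Int_absorb1)
    qed
  qed
  then show ?thesis
    using distr_uniform01_Pair_coupling f g by (auto simp: comonotone_coupling_def)
qed

lemma nondecreasing_rearrangement_comonotone:
  assumes "real_distribution \<mu>" "real_distribution \<nu>"
  shows "comonotone_coupling \<mu> \<nu> (nondecreasing_rearrangement \<mu> \<nu>)"
  unfolding nondecreasing_rearrangement_def
  by (intro distr_uniform01_mono_comonotone mono_on_quantile assms measurable_quantile(2)
      measurable_quantile(1)[folded measurable_uniform01_eq])

lemma nonincreasing_rearrangement_coupling:
  assumes "real_distribution \<mu>" "real_distribution \<nu>"
  shows "nonincreasing_rearrangement \<mu> \<nu> \<in> couplings \<mu> \<nu>"
  unfolding nonincreasing_rearrangement_def
  using distr_uniform01_reflect[OF measurable_quantile(1)[OF assms(2)]] measurable_quantile(2)[OF assms(2)]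
  by (intro distr_uniform01_Pair_coupling assms measurable_quantile(2)
      measurable_quantile(1)[folded measurable_uniform01_eq]
      measurable_quantile_reflect[folded measurable_uniform01_eq]) simp

section \<open>Reflection of the second coordinate\<close>

definition reflect_snd :: "(real \<times> real) measure \<Rightarrow> (real \<times> real) measure" where
  "reflect_snd \<pi> = distr \<pi> borel (\<lambda>z. (fst z, - snd z))"

lemma measurable_reflect_snd:
  assumes "sets \<pi> = sets (borel :: (real \<times> real) measure)"
  shows "(\<lambda>z. (fst z, - snd z)) \<in> measurable \<pi> (borel :: (real \<times> real) measure)"
proof -
  note [measurable] = measurable_borel_fst_snd
  have "(\<lambda>z. (fst z, - snd z)) \<in> measurable borel (borel \<Otimes>\<^sub>M borel :: (real \<times> real) measure)"
    by measurable
  then show ?thesis unfolding borel_prod measurable_cong_sets[OF assms refl] .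
qed

lemma reflect_snd_reflect_snd:
  assumes "sets \<pi> = sets borel"
  shows "reflect_snd (reflect_snd \<pi>) = \<pi>"
proof -
  have "reflect_snd (reflect_snd \<pi>) = distr \<pi> borel (\<lambda>z. z)"
    unfolding reflect_snd_def
    by (subst distr_distr) (auto intro!: measurable_reflect_snd assms simp: o_def)
  then show ?thesis using assms by (simp add: distr_id2)
qed

lemma reflect_snd_coupling:
  assumes c: "\<pi> \<in> couplings \<mu> \<nu>"
  shows "reflect_snd \<pi> \<in> couplings \<mu> (distr \<nu> borel uminus)"
proof -
  interpret prob_space \<pi> using c by (simp add: couplings_def)
  have sets: "sets \<pi> = sets borel" using c by (simp add: couplings_def)
  note m = measurable_reflect_snd[OF sets]
  have "distr (distr \<pi> borel snd) borel uminus = distr \<pi> borel (\<lambda>z. - snd z)"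
    by (subst distr_distr) (use measurable_coupling[OF c] in \<open>auto simp: o_def\<close>)
  then show ?thesis
    using c prob_space_distr[OF m] m measurable_borel_fst_snd
    by (auto simp: couplings_def reflect_snd_def distr_distr o_def)
qed

text \<open>The integrand sees the second coordinates only through their squared difference, which
  survives negating both.\<close>

lemma gw_cost_reflect_snd:
  assumes c: "\<pi> \<in> couplings \<mu> \<nu>"
  shows "gw_cost (reflect_snd \<pi>) = gw_cost \<pi>"
proof -
  have sets: "sets \<pi> = sets borel" and P: "prob_space \<pi>" using c by (auto simp: couplings_def)
  note m = measurable_reflect_snd[OF sets]
  note nd = nn_integral_distr[OF m, unfolded measurable_distr_eq1]
  have P': "prob_space (reflect_snd \<pi>)" unfolding reflect_snd_def by (rule prob_space.prob_space_distr[OF P m])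
  interpret R: sigma_finite_measure "reflect_snd \<pi>" using P' by (rule prob_space_imp_sigma_finite)
  let ?c = "\<lambda>z z'. ((fst z - fst z')\<^sup>2 - (snd z - snd z')\<^sup>2)\<^sup>2 :: real"
  \<comment> \<open>The outer change of variables needs the inner integral to be Borel in
    \<open>z'\<close>, which follows from joint measurability.\<close>
  have cm: "(\<lambda>q. ?c (snd q) (fst q)) \<in> borel_measurable (borel :: ((real \<times> real) \<times> (real \<times> real)) measure)"
    by (intro borel_measurable_continuous_onI continuous_intros)
  have sets_eq: "sets (borel \<Otimes>\<^sub>M reflect_snd \<pi>) = sets (borel :: ((real \<times> real) \<times> (real \<times> real)) measure)"
  proof -
    have "sets (borel \<Otimes>\<^sub>M reflect_snd \<pi>) = sets ((borel :: (real \<times> real) measure) \<Otimes>\<^sub>M (borel :: (real \<times> real) measure))"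
      by (intro sets_pair_measure_cong) (simp_all add: reflect_snd_def)
    then show ?thesis by (simp only: borel_prod)
  qed
  have joint: "(\<lambda>q. ennreal (?c (snd q) (fst q))) \<in> borel_measurable (borel \<Otimes>\<^sub>M reflect_snd \<pi>)"
    unfolding measurable_cong_sets[OF sets_eq refl]
    by (rule measurable_compose[OF cm measurable_ennreal])
  have inner: "(\<lambda>z. ennreal (?c z z')) \<in> borel_measurable borel" for z' :: "real \<times> real"
    by (rule measurable_compose[OF borel_measurable_continuous_onI measurable_ennreal]) (intro continuous_intros)
  have meas: "(\<lambda>z'. \<integral>\<^sup>+ z. ennreal (?c z z') \<partial>reflect_snd \<pi>) \<in> borel_measurable borel"
    using R.borel_measurable_nn_integral_fst[OF joint] by simp
  have "gw_cost (reflect_snd \<pi>) = (\<integral>\<^sup>+ z'. (\<integral>\<^sup>+ z. ennreal (?c z z') \<partial>reflect_snd \<pi>) \<partial>reflect_snd \<pi>)"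
    by (simp add: gw_cost_def case_prod_unfold)
  also have "\<dots> = (\<integral>\<^sup>+ z'. (\<integral>\<^sup>+ z. ennreal (?c z (fst z', - snd z')) \<partial>reflect_snd \<pi>) \<partial>\<pi>)"
    by (rule nd[OF meas, folded reflect_snd_def])
  also have "\<dots> = (\<integral>\<^sup>+ z'. (\<integral>\<^sup>+ z. ennreal (?c (fst z, - snd z) (fst z', - snd z')) \<partial>\<pi>) \<partial>\<pi>)"
    unfolding reflect_snd_def nd[OF inner] ..
  also have "\<dots> = gw_cost \<pi>"
    by (simp add: gw_cost_def case_prod_unfold power2_commute)
  finally show ?thesis .
qed

section \<open>Cluster structure of the mixtures and of their reflections\<close>

lemma mixture_shift_two_clusters:
  fixes M N :: "real measure" and a R K t :: real
  assumes M: "real_distribution M" "AE x in M. x \<in> {a..a+R}"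
    and N: "real_distribution N" "AE x in N. x \<in> {a..a+R}"
    and K: "R < K" and t: "0 < t" "t < 1"
  defines "\<mu> \<equiv> mixture t M (distr N borel (\<lambda>x. x + K))"
  shows "real_distribution \<mu>" and "AE x in \<mu>. x \<in> {a..a+R} \<union> {a+K..a+K+R}"
    and "measure \<mu> {a+R<..} = t"
proof -
  interpret M: real_distribution M by fact
  interpret N: real_distribution N by fact
  have rN: "real_distribution (distr N borel (\<lambda>x. x + K))"
    by (rule N.real_distribution_distr) simp
  show rd: "real_distribution \<mu>"
    unfolding \<mu>_def using t by (intro real_distribution_mixture M rN) auto
  interpret real_distribution \<mu> by fact
  have em: "emeasure \<mu> B = ennreal (1 - t) * emeasure M B + ennreal t * emeasure N ((\<lambda>x. x + K) -` B)"
    if "B \<in> sets borel" for B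
    unfolding \<mu>_def using that by (simp add: emeasure_mixture emeasure_distr)
  let ?S = "- ({a..a+R} \<union> {a+K..a+K+R})"
  have null: "emeasure L B = 0"
    if "AE x in L. x \<in> {a..a+R}" "B \<in> sets L" "B \<inter> {a..a+R} = {}" for L :: "real measure" and B
  proof -
    have "AE x in L. x \<notin> B" using that(1) by eventually_elim (use that(3) in blast)
    then show ?thesis using AE_iff_null_sets[OF that(2)] by auto
  qed
  have sh: "(\<lambda>x. x + K) -` B \<in> sets borel" if "B \<in> sets borel" for B
    using measurable_sets[of "\<lambda>x. x + K" borel borel B] that by simp
  have "emeasure M ?S = 0"
    by (rule null[OF M(2)]) auto
  moreover have "emeasure N ((\<lambda>x. x + K) -` ?S) = 0"
    by (rule null[OF N(2)]) (auto intro!: sh simp del: vimage_Compl)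
  ultimately have "emeasure \<mu> ?S = 0" by (subst em) auto
  then show "AE x in \<mu>. x \<in> {a..a+R} \<union> {a+K..a+K+R}"
    by (intro AE_I[of _ _ ?S]) auto
  \<comment> \<open>As \<open>R < K\<close>, the threshold \<open>a + R\<close> separates the
    components: the shifted one lies above it, the other one does not.\<close>
  have "emeasure M {a+R<..} = 0"
    by (rule null[OF M(2)]) auto
  moreover have "emeasure N ((\<lambda>x. x + K) -` {a+R<..}) = 1"
  proof (rule N.emeasure_eq_1_AE)
    show "AE x in N. x \<in> (\<lambda>x. x + K) -` {a+R<..}"
      using N(2) by eventually_elim (use K in auto)
  qed (auto intro!: sh)
  ultimately have "emeasure \<mu> {a+R<..} = ennreal t" by (subst em) auto
  then show "measure \<mu> {a+R<..} = t" using t by (simp add: measure_def)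
qed

text \<open>Negation swaps the clusters, so the upper mass becomes \<open>1 - t\<close>. The
  reflected \<nu> therefore matches the upper mass of \<mu> only for \<open>t = 1/2\<close>.\<close>

lemma two_cluster_uminus:
  fixes \<nu> :: "real measure" and a R K t :: real
  assumes nu: "real_distribution \<nu>" and supp: "AE y in \<nu>. y \<in> {a..a+R} \<union> {a+K..a+K+R}"
    and up: "measure \<nu> {a+R<..} = t" and K: "R < K" and b: "b = - (a + K + R)"
  shows "real_distribution (distr \<nu> borel uminus)"
    and "AE y in distr \<nu> borel uminus. y \<in> {b..b+R} \<union> {b+K..b+K+R}"
    and "measure (distr \<nu> borel uminus) {b+R<..} = 1 - t"
proof -
  interpret real_distribution \<nu> by fact
  show "real_distribution (distr \<nu> borel uminus)" by (rule real_distribution_distr) simp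
  show "AE y in distr \<nu> borel uminus. y \<in> {b..b+R} \<union> {b+K..b+K+R}"
  proof (subst AE_distr_iff)
    show "AE y in \<nu>. - y \<in> {b..b+R} \<union> {b+K..b+K+R}"
      using supp by eventually_elim (auto simp: b)
  qed auto
  have "measure (distr \<nu> borel uminus) {b+R<..} = prob (uminus -` {b+R<..})"
    by (subst measure_distr) auto
  \<comment> \<open>The preimage is \<open>y < a + K\<close>, which agrees with
    \<open>y \<le> a + R\<close> only on the clusters, hence almost everywhere.\<close>
  also have "\<dots> = prob (space \<nu> - {a+R<..})"
  proof (rule finite_measure_eq_AE)
    show "AE y in \<nu>. (y \<in> uminus -` {b+R<..}) = (y \<in> space \<nu> - {a+R<..})"
      using supp by eventually_elim (use K in \<open>auto simp: b\<close>)
  qed (auto intro: measurable_sets_borel[of uminus borel])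
  also have "\<dots> = 1 - t" using up by (subst prob_compl) auto
  finally show "measure (distr \<nu> borel uminus) {b+R<..} = 1 - t" .
qed

text \<open>Reversing the quantile and negating it are both order-reversing, so
  \<open>- quantile \<nu> (1 - u)\<close> is nondecreasing, with the reflected \<nu> as its
  law.\<close>

lemma reflect_nonincreasing_comonotone:
  assumes mu: "real_distribution \<mu>" and nu: "real_distribution \<nu>"
  shows "comonotone_coupling \<mu> (distr \<nu> borel uminus) (reflect_snd (nonincreasing_rearrangement \<mu> \<nu>))"
proof -
  note mq = measurable_quantile(1)[OF mu, folded measurable_uniform01_eq]
  note nq = measurable_quantile_reflect[OF nu, folded measurable_uniform01_eq]
  have Pair: "(\<lambda>u. (quantile \<mu> u, quantile \<nu> (1 - u))) \<in> measurable uniform01 borel"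
    using mq nq by (simp add: borel_prod[symmetric])
  have "reflect_snd (nonincreasing_rearrangement \<mu> \<nu>) =
      distr uniform01 borel (\<lambda>u. (quantile \<mu> u, - quantile \<nu> (1 - u)))"
    unfolding reflect_snd_def nonincreasing_rearrangement_def
    by (subst distr_distr) (use Pair in \<open>auto intro!: measurable_reflect_snd simp: o_def\<close>)
  moreover have "comonotone_coupling \<mu> (distr \<nu> borel uminus)
      (distr uniform01 borel (\<lambda>u. (quantile \<mu> u, - quantile \<nu> (1 - u))))"
  proof (rule distr_uniform01_mono_comonotone[OF mq measurable_quantile(2)[OF mu] mono_on_quantile[OF mu]])
    show "(\<lambda>u. - quantile \<nu> (1 - u)) \<in> borel_measurable uniform01" using nq by simp
    have "distr uniform01 borel (\<lambda>u. quantile \<nu> (1 - u)) = \<nu>"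
      using distr_uniform01_reflect[OF measurable_quantile(1)[OF nu]] measurable_quantile(2)[OF nu] by simp
    moreover have "distr (distr uniform01 borel (\<lambda>u. quantile \<nu> (1 - u))) borel uminus
        = distr uniform01 borel (\<lambda>u. - quantile \<nu> (1 - u))"
      by (subst distr_distr) (use nq in \<open>auto simp: o_def\<close>)
    ultimately show "distr uniform01 borel (\<lambda>u. - quantile \<nu> (1 - u)) = distr \<nu> borel uminus" by simp
    show "mono_on {0<..<1} (\<lambda>u. - quantile \<nu> (1 - u))"
      by (rule mono_onI) (auto intro!: mono_onD[OF mono_on_quantile[OF nu]])
  qed
  ultimately show ?thesis by simp
qed

section \<open>Comparison of arbitrary plans with the rearrangements\<close>

lemma (in two_clusters) cost_gt_rearrangement_balanced:
  assumes half: "t = 1/2" and K1600: "1600 * R \<le> K" and c: "\<pi> \<in> couplings \<mu> \<nu>"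
  shows "\<pi> = nondecreasing_rearrangement \<mu> \<nu> \<or> \<pi> = nonincreasing_rearrangement \<mu> \<nu> \<or>
    gw_cost (nondecreasing_rearrangement \<mu> \<nu>) < gw_cost \<pi> \<or> gw_cost (nonincreasing_rearrangement \<mu> \<nu>) < gw_cost \<pi>"
proof (cases "cross_mass \<pi> \<le> 1/4")
  case True
  \<comment> \<open>The value 1/8 is \<open>1/4 - p / 2\<close> at the threshold
    \<open>p = 1/4\<close>, and 1600 is 200 divided by it.\<close>
  then show ?thesis
    using comonotone_cost_less[OF nondecreasing_rearrangement_comonotone[OF mu nu] c, of "1/8"] half K1600 by auto
next
  case False
  let ?b = "- (b + K + R)" and ?\<nu> = "distr \<nu> borel uminus" and ?dec = "nonincreasing_rearrangement \<mu> \<nu>"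
  note u = two_cluster_uminus[OF nu nu_clusters nu_upper K refl]
  have u3: "measure ?\<nu> {?b+R<..} = t" using u(3) half by simp
  interpret F: two_clusters \<mu> ?\<nu> a ?b R K t
    by (rule two_clusters.intro[OF mu u(1) mu_clusters u(2) mu_upper u3 R K t])
  interpret prob_space \<pi> using c by (simp add: couplings_def)
  have sets: "sets \<pi> = sets borel" using c by (simp add: couplings_def)
  have sp: "space \<pi> = UNIV" using sets_eq_imp_space_eq[OF sets] by simp
  note rc = reflect_snd_coupling[OF c]
  have rect: "{a+R<..} \<times> {?b+R<..} \<in> sets (borel :: (real \<times> real) measure)"
    by (simp add: borel_prod[symmetric])
  \<comment> \<open>The upper-upper block of the reflected plan is the upper-lower block of \<pi>,
    so its cross mass is \<open>1/2 - cross_mass \<pi>\<close>.\<close>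
  have "joint_survival (reflect_snd \<pi>) (a+R) (?b+R) = measure \<pi> ((\<lambda>z. (fst z, - snd z)) -` ({a+R<..} \<times> {?b+R<..}))"
    unfolding joint_survival_def reflect_snd_def
    by (subst measure_distr[OF measurable_reflect_snd[OF sets] rect]) (simp add: sp)
  also have "\<dots> = measure \<pi> ({a+R<..} \<times> {..b+R})"
  proof (rule finite_measure_eq_AE)
    show "AE z in \<pi>. (z \<in> (\<lambda>z. (fst z, - snd z)) -` ({a+R<..} \<times> {?b+R<..})) = (z \<in> {a+R<..} \<times> {..b+R})"
      using AE_clusters[OF c] by eventually_elim (use K in \<open>auto simp: mem_Times_iff\<close>)
    show "(\<lambda>z. (fst z, - snd z)) -` ({a+R<..} \<times> {?b+R<..}) \<in> events"
      using measurable_sets[OF measurable_reflect_snd[OF sets] rect] by (simp add: sp)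
  qed (auto intro!: sets_coupling_Times[OF c])
  also have "\<dots> = cross_mass \<pi>" using cross_mass_eq(2)[OF c] by simp
  finally have "F.cross_mass (reflect_snd \<pi>) \<le> 1/4"
    using False half unfolding F.cross_mass_def by simp
  then have "reflect_snd \<pi> = reflect_snd ?dec \<or> gw_cost (reflect_snd ?dec) < gw_cost (reflect_snd \<pi>)"
    using F.comonotone_cost_less[OF reflect_nonincreasing_comonotone[OF mu nu] rc, of "1/8"] half K1600 by auto
  \<comment> \<open>Reflection is an involution, so equality of the reflected plans carries
    back.\<close>
  moreover have "\<pi> = ?dec" if "reflect_snd \<pi> = reflect_snd ?dec"
    using that reflect_snd_reflect_snd[OF sets] reflect_snd_reflect_snd[of ?dec]
    by (simp add: nonincreasing_rearrangement_def)
  ultimately show ?thesis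
    using gw_cost_reflect_snd[OF c] gw_cost_reflect_snd[OF nonincreasing_rearrangement_coupling[OF mu nu]] by auto
qed

text \<open>For \<open>t \<noteq> 1/2\<close> the bound
  \<open>cross_mass \<pi> \<le> min t (1 - t) < 1/2\<close> gives a positive \<kappa> depending on
  \<open>t\<close> alone, uniformly over all plans.\<close>

lemma (in two_clusters) cost_gt_rearrangement_unbalanced:
  assumes ne: "t \<noteq> 1/2" and \<kappa>: "\<kappa> = min (min t (1 - t)) (1/4 - min t (1 - t) / 2)" and K\<kappa>: "200 * R \<le> K * \<kappa>"
    and c: "\<pi> \<in> couplings \<mu> \<nu>"
  shows "\<pi> = nondecreasing_rearrangement \<mu> \<nu> \<or> gw_cost (nondecreasing_rearrangement \<mu> \<nu>) < gw_cost \<pi>"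
proof -
  have "0 < \<kappa>" "\<kappa> \<le> t" "\<kappa> \<le> 1 - t" using t ne by (auto simp: \<kappa> min_def)
  moreover have "\<kappa> \<le> 1/4 - cross_mass \<pi> / 2"
  proof -
    have "cross_mass \<pi> \<le> min t (1 - t)" using cross_mass_bounds[OF c] by simp
    then have "1/4 - min t (1 - t) / 2 \<le> 1/4 - cross_mass \<pi> / 2"
      by (intro diff_left_mono divide_right_mono) auto
    then show ?thesis by (simp only: \<kappa> min.coboundedI2)
  qed
  ultimately show ?thesis
    using comonotone_cost_less[OF nondecreasing_rearrangement_comonotone[OF mu nu] c] K\<kappa> by blast
qed

text \<open>The uniqueness clause excludes a tie at \<open>t = 1/2\<close>: if all four measures are
  the same Dirac mass, both rearrangements are induced by isometries and have cost 0, yet they are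
  different plans.\<close>

theorem proposition3p14:
  fixes A :: "real set" and \<mu>1 \<mu>2 \<nu>1 \<nu>2 :: "real measure" and t :: real
  assumes "compact A" and "is_interval A"
    and "real_distribution \<mu>1" and "AE x in \<mu>1. x \<in> A"
    and "real_distribution \<mu>2" and "AE x in \<mu>2. x \<in> A"
    and "real_distribution \<nu>1" and "AE y in \<nu>1. y \<in> A"
    and "real_distribution \<nu>2" and "AE y in \<nu>2. y \<in> A"
    and "0 < t" and "t < 1"
  shows "\<exists>K0 \<ge> diameter A. \<forall>K > K0.
    (let \<mu> = mixture t \<mu>1 (distr \<mu>2 borel (\<lambda>x. x + K));
         \<nu> = mixture t \<nu>1 (distr \<nu>2 borel (\<lambda>x. x + K));
         \<pi>_inc = nondecreasing_rearrangement \<mu> \<nu>;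
         \<pi>_dec = nonincreasing_rearrangement \<mu> \<nu>
     in (\<exists>\<pi>. gw_optimal \<mu> \<nu> \<pi>) \<and>
        (\<forall>\<pi>. gw_optimal \<mu> \<nu> \<pi> \<longrightarrow> \<pi> = \<pi>_inc \<or> \<pi> = \<pi>_dec) \<and>
        (t \<noteq> 1 / 2 \<or> gw_cost \<pi>_inc \<noteq> gw_cost \<pi>_dec \<longrightarrow> (\<exists>!\<pi>. gw_optimal \<mu> \<nu> \<pi>)))"
proof -
  \<comment> \<open>The added 1 ensures \<open>1 \<le> R\<close> even if \<open>A\<close> is a
    single point.\<close>
  define R where "R = diameter A + 1"
  define a where "a = Inf A"
  \<comment> \<open>The constants of the balanced and unbalanced comparisons. They depend on
    \<open>t\<close> only, so the threshold \<open>200 * R / \<kappa>\<close> does not involve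
    \<open>K\<close>.\<close>
  define \<kappa> where "\<kappa> = (if t = 1/2 then 1/8 else min (min t (1 - t)) (1/4 - min t (1 - t) / 2))"
  have \<kappa>: "0 < \<kappa>" "\<kappa> \<le> 1" using assms by (auto simp: \<kappa>_def min_def)
  have bA: "bounded A" using assms by (simp add: compact_imp_bounded)
  have R: "1 \<le> R" using diameter_ge_0[OF bA] by (simp add: R_def)
  have A: "x \<in> {a..a+R}" if "x \<in> A" for x
  proof -
    have "x - diameter A \<le> Inf A"
    proof (rule cInf_greatest)
      fix y assume "y \<in> A"
      then show "x - diameter A \<le> y"
        using diameter_bounded_bound[OF bA that, of y] by (simp add: dist_real_def)
    qed (use that in auto)
    moreover have "Inf A \<le> x" using that bA by (intro cInf_lower bounded_imp_bdd_below)
    ultimately show ?thesis by (simp add: a_def R_def)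
  qed
  note AE = assms(4)[THEN AE_mp, OF AE_I2, OF impI, OF A] assms(6)[THEN AE_mp, OF AE_I2, OF impI, OF A]
    assms(8)[THEN AE_mp, OF AE_I2, OF impI, OF A] assms(10)[THEN AE_mp, OF AE_I2, OF impI, OF A]
  have RK: "R \<le> 200 * R / \<kappa>" using \<kappa> R by (simp add: field_simps)
  show ?thesis
  proof (intro exI[of _ "200 * R / \<kappa>"] conjI allI impI)
    show "diameter A \<le> 200 * R / \<kappa>" using RK by (simp add: R_def)
    fix K assume "200 * R / \<kappa> < K"
    note K_gt = this
    then have K: "R < K" using RK by linarith
    have K\<kappa>: "200 * R \<le> K * \<kappa>" using K_gt \<kappa> by (simp add: field_simps)
    define \<mu> where "\<mu> = mixture t \<mu>1 (distr \<mu>2 borel (\<lambda>x. x + K))"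
    define \<nu> where "\<nu> = mixture t \<nu>1 (distr \<nu>2 borel (\<lambda>x. x + K))"
    define inc where "inc = nondecreasing_rearrangement \<mu> \<nu>"
    define dec where "dec = nonincreasing_rearrangement \<mu> \<nu>"
    note mu = mixture_shift_two_clusters[OF assms(3) AE(1) assms(5) AE(2) K assms(11,12), folded \<mu>_def]
    note nu = mixture_shift_two_clusters[OF assms(7) AE(3) assms(9) AE(4) K assms(11,12), folded \<nu>_def]
    interpret two_clusters \<mu> \<nu> a a R K t
      by (rule two_clusters.intro[OF mu(1) nu(1) mu(2) nu(2) mu(3) nu(3) R K assms(11,12)])
    have inc: "inc \<in> couplings \<mu> \<nu>"
      using nondecreasing_rearrangement_comonotone[OF mu(1) nu(1)] by (simp add: inc_def comonotone_coupling_def)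
    have dec: "dec \<in> couplings \<mu> \<nu>"
      using nonincreasing_rearrangement_coupling[OF mu(1) nu(1)] by (simp add: dec_def)
    have opt: "gw_optimal \<mu> \<nu> \<pi> \<longleftrightarrow> \<pi> \<in> couplings \<mu> \<nu> \<and> (\<forall>\<pi>' \<in> couplings \<mu> \<nu>. gw_cost \<pi> \<le> gw_cost \<pi>')" for \<pi>
      by (auto simp: gw_optimal_def is_arg_min_def not_less)
    have "(\<exists>\<pi>. gw_optimal \<mu> \<nu> \<pi>) \<and> (\<forall>\<pi>. gw_optimal \<mu> \<nu> \<pi> \<longrightarrow> \<pi> = inc \<or> \<pi> = dec) \<and>
        (t \<noteq> 1 / 2 \<or> gw_cost inc \<noteq> gw_cost dec \<longrightarrow> (\<exists>!\<pi>. gw_optimal \<mu> \<nu> \<pi>))"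
    proof (cases "t = 1/2")
      case False
      then have *: "\<pi> = inc \<or> gw_cost inc < gw_cost \<pi>" if "\<pi> \<in> couplings \<mu> \<nu>" for \<pi>
        using cost_gt_rearrangement_unbalanced[OF False refl _ that] K\<kappa> by (simp add: \<kappa>_def inc_def)
      have "gw_optimal \<mu> \<nu> \<pi> \<longleftrightarrow> \<pi> = inc" for \<pi>
        unfolding opt using * inc by (metis leD order_less_imp_le order_refl)
      then show ?thesis by auto
    next
      case True
      then have *: "\<pi> = inc \<or> \<pi> = dec \<or> gw_cost inc < gw_cost \<pi> \<or> gw_cost dec < gw_cost \<pi>" if "\<pi> \<in> couplings \<mu> \<nu>" for \<pi>
        using cost_gt_rearrangement_balanced[OF True _ that] K\<kappa> by (simp add: \<kappa>_def inc_def dec_def)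
      have only: "\<pi> = inc \<or> \<pi> = dec" if "gw_optimal \<mu> \<nu> \<pi>" for \<pi>
        using that * inc dec unfolding opt by (meson leD)
      \<comment> \<open>Any other plan is strictly beaten by one of the two rearrangements, so the
        cheaper of them is a minimiser.\<close>
      have inc_opt: "gw_optimal \<mu> \<nu> inc" if "gw_cost inc \<le> gw_cost dec"
        unfolding opt
      proof (intro conjI ballI inc)
        fix \<pi>' assume "\<pi>' \<in> couplings \<mu> \<nu>"
        from *[OF this] that show "gw_cost inc \<le> gw_cost \<pi>'" by (elim disjE) auto
      qed
      have dec_opt: "gw_optimal \<mu> \<nu> dec" if "gw_cost dec \<le> gw_cost inc"
        unfolding opt
      proof (intro conjI ballI dec)
        fix \<pi>' assume "\<pi>' \<in> couplings \<mu> \<nu>"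
        from *[OF this] that show "gw_cost dec \<le> gw_cost \<pi>'" by (elim disjE) auto
      qed
      have ex: "\<exists>\<pi>. gw_optimal \<mu> \<nu> \<pi>" using inc_opt dec_opt linear by blast
      moreover have "\<exists>!\<pi>. gw_optimal \<mu> \<nu> \<pi>" if "gw_cost inc \<noteq> gw_cost dec"
      proof (rule ex_ex1I[OF ex])
        \<comment> \<open>Two different minimisers would have to be \<open>inc\<close> and
          \<open>dec\<close>, with equal cost.\<close>
        fix \<pi> \<pi>' assume "gw_optimal \<mu> \<nu> \<pi>" "gw_optimal \<mu> \<nu> \<pi>'"
        moreover from this have "gw_cost \<pi> = gw_cost \<pi>'" unfolding opt by (auto intro: antisym)
        ultimately show "\<pi> = \<pi>'" using only that by metis
      qed
      ultimately show ?thesis using only True by blast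
    qed
    then show "let \<mu> = mixture t \<mu>1 (distr \<mu>2 borel (\<lambda>x. x + K));
         \<nu> = mixture t \<nu>1 (distr \<nu>2 borel (\<lambda>x. x + K));
         \<pi>_inc = nondecreasing_rearrangement \<mu> \<nu>;
         \<pi>_dec = nonincreasing_rearrangement \<mu> \<nu>
     in (\<exists>\<pi>. gw_optimal \<mu> \<nu> \<pi>) \<and>
        (\<forall>\<pi>. gw_optimal \<mu> \<nu> \<pi> \<longrightarrow> \<pi> = \<pi>_inc \<or> \<pi> = \<pi>_dec) \<and>
        (t \<noteq> 1 / 2 \<or> gw_cost \<pi>_inc \<noteq> gw_cost \<pi>_dec \<longrightarrow> (\<exists>!\<pi>. gw_optimal \<mu> \<nu> \<pi>))"
      unfolding Let_def \<mu>_def \<nu>_def inc_def dec_def .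
  qed
qed

end
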